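(* The group given by the presentation $\langle a, t \mid t^2 a t^{-2} = a^2\rangle$ is residually finite but not linear.
   Context: A group is called linear if it is isomorphic to a subgroup of $\mathrm{GL}_n(K)$ for some positive integer $n$ and some field $K$ (equivalently, it has a faithful finite-dimensional representation over some field). A group $G$ is residually finite if for every $g \in G$ with $g \neq 1$ there is a homomorphism from $G$ to a finite group that does not map $g$ to $1$. *)

theory Defs
  imports "Jordan_Normal_Form.Matrix" "HOL-Algebra.Coset"
begin

section \<open>Group presentations\<close>

datatype 'x letter = Gen 'x | Inv 'x

type_synonym 'x word = "'x letter list"

text \<open>A presentation has the whole type \<^typ>\<open>'x\<close> as its set of generators; a pair
  \<open>(u, v) \<in> R\<close> is the defining relation \<open>u = v\<close>.  The group is the set of words modulo the least
  congruence that makes \<open>Gen x\<close> and \<open>Inv x\<close> mutually inverse and identifies the two sides of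
  each defining relation; it is the quotient of the free group on \<^typ>\<open>'x\<close> by
  the normal closure of the elements \<open>u v\<inverse>\<close>.\<close>

inductive word_eq :: "('x word \<times> 'x word) set \<Rightarrow> 'x word \<Rightarrow> 'x word \<Rightarrow> bool"
  for R :: "('x word \<times> 'x word) set"
where
  relation: "(u, v) \<in> R \<Longrightarrow> word_eq R u v"
| cancel_right: "word_eq R [Gen x, Inv x] []"
| cancel_left: "word_eq R [Inv x, Gen x] []"
| refl: "word_eq R u u"
| sym: "word_eq R u v \<Longrightarrow> word_eq R v u"
| trans: "word_eq R u v \<Longrightarrow> word_eq R v w \<Longrightarrow> word_eq R u w"
| append: "word_eq R u u' \<Longrightarrow> word_eq R v v' \<Longrightarrow> word_eq R (u @ v) (u' @ v')"

definition word_class :: "('x word \<times> 'x word) set \<Rightarrow> 'x word \<Rightarrow> 'x word set" where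
  "word_class R u = {v. word_eq R u v}"

definition presented_group :: "('x word \<times> 'x word) set \<Rightarrow> 'x word set monoid" where
  "presented_group R =
    \<lparr>carrier = range (word_class R),
     mult = (\<lambda>A B. \<Union>u\<in>A. \<Union>v\<in>B. word_class R (u @ v)),
     one = word_class R []\<rparr>"

lemma word_class_eq_iff: "word_class R u = word_class R v \<longleftrightarrow> word_eq R u v"
  unfolding word_class_def by (auto intro: word_eq.refl word_eq.sym word_eq.trans)

lemma carrier_presented_group: "carrier (presented_group R) = range (word_class R)"
  by (simp add: presented_group_def)

lemma one_presented_group: "\<one>\<^bsub>presented_group R\<^esub> = word_class R []"
  by (simp add: presented_group_def)

lemma mult_presented_group:
  "word_class R u \<otimes>\<^bsub>presented_group R\<^esub> word_class R v = word_class R (u @ v)"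
proof -
  have "word_class R (u' @ v') = word_class R (u @ v)"
    if "u' \<in> word_class R u" "v' \<in> word_class R v" for u' v'
    using that unfolding word_class_eq_iff unfolding word_class_def
    by (simp add: word_eq.append word_eq.sym)
  then have "(\<Union>u'\<in>word_class R u. \<Union>v'\<in>word_class R v. word_class R (u' @ v'))
      = (\<Union>u'\<in>word_class R u. \<Union>v'\<in>word_class R v. word_class R (u @ v))"
    by simp
  moreover have "u \<in> word_class R u" "v \<in> word_class R v"
    by (simp_all add: word_class_def word_eq.refl)
  ultimately have "(\<Union>u'\<in>word_class R u. \<Union>v'\<in>word_class R v. word_class R (u' @ v'))
      = word_class R (u @ v)"
    by blast
  then show ?thesis
    by (simp add: presented_group_def)
qed

fun letter_inv :: "'x letter \<Rightarrow> 'x letter" where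
  "letter_inv (Gen x) = Inv x"
| "letter_inv (Inv x) = Gen x"

definition word_inv :: "'x word \<Rightarrow> 'x word" where
  "word_inv u = rev (map letter_inv u)"

lemma word_inv_left: "word_eq R (word_inv u @ u) []"
proof (induction u)
  case Nil
  show ?case by (simp add: word_inv_def word_eq.refl)
next
  case (Cons l u)
  have "word_eq R [letter_inv l, l] []"
    by (cases l) (auto intro: word_eq.cancel_left word_eq.cancel_right)
  then have "word_eq R (word_inv u @ [letter_inv l, l] @ u) (word_inv u @ [] @ u)"
    by (intro word_eq.append word_eq.refl)
  then show ?case
    using Cons.IH by (auto simp: word_inv_def intro: word_eq.trans)
qed

lemma group_presented_group: "group (presented_group R)"
proof (rule groupI)
  show "x \<otimes>\<^bsub>presented_group R\<^esub> y \<in> carrier (presented_group R)"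
    if "x \<in> carrier (presented_group R)" "y \<in> carrier (presented_group R)" for x y
    using that unfolding carrier_presented_group by (elim rangeE) (simp add: mult_presented_group)
  show "\<one>\<^bsub>presented_group R\<^esub> \<in> carrier (presented_group R)"
    by (simp add: carrier_presented_group one_presented_group)
  show "x \<otimes>\<^bsub>presented_group R\<^esub> y \<otimes>\<^bsub>presented_group R\<^esub> z =
      x \<otimes>\<^bsub>presented_group R\<^esub> (y \<otimes>\<^bsub>presented_group R\<^esub> z)"
    if "x \<in> carrier (presented_group R)" "y \<in> carrier (presented_group R)"
      "z \<in> carrier (presented_group R)" for x y z
    using that unfolding carrier_presented_group by (elim rangeE) (simp add: mult_presented_group)
  show "\<one>\<^bsub>presented_group R\<^esub> \<otimes>\<^bsub>presented_group R\<^esub> x = x"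
    if "x \<in> carrier (presented_group R)" for x
    using that unfolding carrier_presented_group one_presented_group
    by (elim rangeE) (simp add: mult_presented_group)
  show "\<exists>y\<in>carrier (presented_group R). y \<otimes>\<^bsub>presented_group R\<^esub> x = \<one>\<^bsub>presented_group R\<^esub>"
    if "x \<in> carrier (presented_group R)" for x
  proof -
    from that obtain u where u: "x = word_class R u" by (auto simp: carrier_presented_group)
    show ?thesis
    proof (rule bexI)
      show "word_class R (word_inv u) \<otimes>\<^bsub>presented_group R\<^esub> x = \<one>\<^bsub>presented_group R\<^esub>"
        by (simp add: u mult_presented_group one_presented_group word_class_eq_iff word_inv_left)
      show "word_class R (word_inv u) \<in> carrier (presented_group R)"
        unfolding carrier_presented_group by (rule rangeI)
    qed
  qed
qed

fun letter_eval :: "('g, 'm) monoid_scheme \<Rightarrow> ('x \<Rightarrow> 'g) \<Rightarrow> 'x letter \<Rightarrow> 'g" where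
  "letter_eval H f (Gen x) = f x"
| "letter_eval H f (Inv x) = inv\<^bsub>H\<^esub> f x"

fun word_eval :: "('g, 'm) monoid_scheme \<Rightarrow> ('x \<Rightarrow> 'g) \<Rightarrow> 'x word \<Rightarrow> 'g" where
  "word_eval H f [] = \<one>\<^bsub>H\<^esub>"
| "word_eval H f (l # u) = letter_eval H f l \<otimes>\<^bsub>H\<^esub> word_eval H f u"

text \<open>The universal property of the presentation (von Dyck).\<close>

lemma presented_group_hom:
  assumes H: "group H" and f: "\<And>x. f x \<in> carrier H"
    and R: "\<And>u v. (u, v) \<in> R \<Longrightarrow> word_eval H f u = word_eval H f v"
  shows "\<exists>\<phi>\<in>hom (presented_group R) H. \<forall>u. \<phi> (word_class R u) = word_eval H f u"
proof -
  interpret H: group H by (rule H)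
  have closed: "word_eval H f u \<in> carrier H" for u
  proof (induction u)
    case (Cons l u)
    then show ?case using f by (cases l) auto
  qed auto
  have lclosed: "letter_eval H f l \<in> carrier H" for l
    using f by (cases l) auto
  have app: "word_eval H f (u @ v) = word_eval H f u \<otimes>\<^bsub>H\<^esub> word_eval H f v" for u v
    by (induction u) (auto simp: closed lclosed H.m_assoc)
  have resp: "word_eval H f u = word_eval H f v" if "word_eq R u v" for u v
    using that by induction (auto simp: R f app)
  define \<phi> where "\<phi> A = word_eval H f (SOME u. word_class R u = A)" for A
  have \<phi>: "\<phi> (word_class R u) = word_eval H f u" for u
  proof -
    have "word_class R (SOME v. word_class R v = word_class R u) = word_class R u"
      by (rule someI) (rule HOL.refl)
    then show ?thesis
      unfolding \<phi>_def word_class_eq_iff by (rule resp)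
  qed
  then have "\<phi> \<in> hom (presented_group R) H"
    by (auto simp: hom_def carrier_presented_group mult_presented_group closed app)
  with \<phi> show ?thesis by blast
qed


section \<open>Residual finiteness\<close>

text \<open>The finite groups range over those whose elements are natural numbers, since HOL cannot
  quantify over types inside a formula.  Every finite group has an isomorphic copy of this form;
  \<open>residually_finiteI\<close> below allows finite groups on any type.\<close>

definition residually_finite :: "('a, 'm) monoid_scheme \<Rightarrow> bool" where
  "residually_finite G \<longleftrightarrow>
    (\<forall>g\<in>carrier G. g \<noteq> \<one>\<^bsub>G\<^esub> \<longrightarrow>
      (\<exists>(F :: nat monoid) \<phi>. group F \<and> finite (carrier F) \<and> \<phi> \<in> hom G F \<and> \<phi> g \<noteq> \<one>\<^bsub>F\<^esub>))"

lemma finite_group_nat_copy: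
  fixes F :: "('b, 'm) monoid_scheme"
  assumes F: "group F" and fin: "finite (carrier F)"
  shows "\<exists>(F' :: nat monoid) h. group F' \<and> finite (carrier F') \<and> h \<in> iso F F' \<and> h \<one>\<^bsub>F\<^esub> = \<one>\<^bsub>F'\<^esub>"
proof -
  interpret F: group F by (rule F)
  obtain h :: "'b \<Rightarrow> nat" where h: "inj_on h (carrier F)"
    using finite_imp_inj_to_nat_seg[OF fin] by blast
  define k where "k = the_inv_into (carrier F) h"
  have k: "k (h x) = x" if "x \<in> carrier F" for x
    unfolding k_def by (rule the_inv_into_f_f[OF h that])
  define F' :: "nat monoid" where
    "F' = \<lparr>carrier = h ` carrier F, mult = (\<lambda>m n. h (k m \<otimes>\<^bsub>F\<^esub> k n)), one = h \<one>\<^bsub>F\<^esub>\<rparr>"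
  have "group F'"
  proof (rule groupI)
    fix x assume "x \<in> carrier F'"
    then obtain y where y: "y \<in> carrier F" "x = h y" by (auto simp: F'_def)
    then show "\<exists>z\<in>carrier F'. z \<otimes>\<^bsub>F'\<^esub> x = \<one>\<^bsub>F'\<^esub>"
      by (intro bexI[of _ "h (inv\<^bsub>F\<^esub> y)"]) (auto simp: F'_def k)
  qed (auto simp: F'_def k F.m_assoc)
  moreover have "h \<in> iso F F'"
    by (auto simp: iso_def hom_def bij_betw_def F'_def k h)
  moreover have "finite (carrier F')" "h \<one>\<^bsub>F\<^esub> = \<one>\<^bsub>F'\<^esub>"
    using fin by (auto simp: F'_def)
  ultimately show ?thesis by blast
qed

lemma residually_finiteI:
  fixes G :: "('a, 'm) monoid_scheme"
  assumes "\<And>g. g \<in> carrier G \<Longrightarrow> g \<noteq> \<one>\<^bsub>G\<^esub> \<Longrightarrow>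
    \<exists>(F :: 'b monoid) \<phi>. group F \<and> finite (carrier F) \<and> \<phi> \<in> hom G F \<and> \<phi> g \<noteq> \<one>\<^bsub>F\<^esub>"
  shows "residually_finite G"
  unfolding residually_finite_def
proof (intro ballI impI)
  fix g assume g: "g \<in> carrier G" "g \<noteq> \<one>\<^bsub>G\<^esub>"
  then obtain F :: "'b monoid" and \<phi> where F: "group F" "finite (carrier F)"
    and \<phi>: "\<phi> \<in> hom G F" "\<phi> g \<noteq> \<one>\<^bsub>F\<^esub>"
    using assms by blast
  obtain F' :: "nat monoid" and h where F': "group F'" "finite (carrier F')"
    and h: "h \<in> iso F F'" "h \<one>\<^bsub>F\<^esub> = \<one>\<^bsub>F'\<^esub>"
    using finite_group_nat_copy[OF F] by blast
  have "h \<circ> \<phi> \<in> hom G F'"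
    using h(1) hom_compose[OF \<phi>(1), of h F'] by (simp add: iso_def)
  moreover have "(h \<circ> \<phi>) g \<noteq> \<one>\<^bsub>F'\<^esub>"
  proof -
    have "\<phi> g \<in> carrier F" "\<one>\<^bsub>F\<^esub> \<in> carrier F"
      using hom_in_carrier[OF \<phi>(1) g(1)] monoid.one_closed[OF group.is_monoid[OF F(1)]] by simp_all
    moreover have "inj_on h (carrier F)"
      using h(1) by (auto simp: iso_def bij_betw_def)
    ultimately show ?thesis
      using \<phi>(2) unfolding h(2)[symmetric] by (simp add: inj_on_eq_iff)
  qed
  ultimately show "\<exists>(F :: nat monoid) \<phi>. group F \<and> finite (carrier F) \<and> \<phi> \<in> hom G F \<and> \<phi> g \<noteq> \<one>\<^bsub>F\<^esub>"
    by (intro exI[of _ F'] exI[of _ "h \<circ> \<phi>"] conjI F')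
qed


section \<open>Linear groups\<close>

definition general_linear_group :: "'k::field itself \<Rightarrow> nat \<Rightarrow> 'k mat monoid" where
  "general_linear_group K n = units_of (ring_mat K n ())"

lemma group_general_linear_group: "group (general_linear_group TYPE('k::field) n)"
  unfolding general_linear_group_def
  by (rule monoid.units_group[OF ring.is_monoid[OF ring_mat]])

text \<open>The field is a type, and HOL has no quantifier over types inside a formula.  Non-linearity of
  \<open>G\<close> over every field is the theorem \<open>\<not> linear_over TYPE('k) G\<close> for a type variable \<open>'k\<close> of
  sort \<^class>\<open>field\<close>, which is universally quantified.\<close>

definition linear_over :: "'k::field itself \<Rightarrow> ('a, 'm) monoid_scheme \<Rightarrow> bool" where
  "linear_over K G \<longleftrightarrow>
    (\<exists>n>0. \<exists>H. subgroup H (general_linear_group K n) \<and>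
      G \<cong> (general_linear_group K n)\<lparr>carrier := H\<rparr>)"


datatype generator = gen_a | gen_t

definition G_at :: "generator word set monoid" where
  "G_at = presented_group {([Gen gen_t, Gen gen_t, Gen gen_a, Inv gen_t, Inv gen_t], [Gen gen_a, Gen gen_a])}"

end

theory Submission
  imports Defs "HOL-Algebra.Algebraic_Closure_Type" "HOL-Combinatorics.Permutations"
    "HOL-Computational_Algebra.Polynomial"
begin

text \<open>
  Put \<open>b = t a t\<inverse>\<close>.  The defining relation becomes \<open>t b t\<inverse> = a\<^sup>2\<close>, so conjugation by \<open>t\<close> maps
  \<open>a\<close> to \<open>b\<close> and \<open>b\<close> to \<open>a\<^sup>2\<close>: the group is an ascending HNN extension of \<open>\<langle>a, b\<rangle>\<close>.  Moving
  positive powers of \<open>t\<close> to the right and negative ones to the left writes every element as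
  \<open>t\<^sup>-\<^sup>n w t\<^sup>m\<close>, where \<open>w\<close> alternates between nonzero powers of \<open>a\<close> and of \<open>b\<close>.
  
  Residual finiteness.  Over any commutative ring in which \<open>2\<close> is invertible the group acts on
  quadruples by \<open>a (p, q, u, v) = (p, q, u + p v, v)\<close> and \<open>t\<inverse> (p, q, u, v) = (q, 2 p, v, u)\<close>; then
  \<open>b (p, q, u, v) = (p, q, u, v + q u)\<close>.  The integers modulo an odd \<open>N\<close> give homomorphisms to finite
  permutation groups.  The maps \<open>a\<close>, \<open>b\<close> and \<open>t\<inverse>\<close> have integral formulas, and an element
  \<open>t\<^sup>-\<^sup>n w t\<^sup>m\<close> that acts trivially modulo every odd \<open>N\<close> makes the two integral maps \<open>t\<^sup>-\<^sup>n w\<close> and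
  \<open>t\<^sup>-\<^sup>m\<close> equal.  The product \<open>p q\<close> doubles under \<open>t\<inverse>\<close> and is fixed by \<open>a\<close> and \<open>b\<close>, so \<open>n = m\<close>;
  on the slice \<open>p = q = 2\<close> the maps \<open>a\<close>, \<open>b\<close> are Sanov's matrices, so ping-pong makes \<open>w\<close> empty
  (\<open>turn_word_act_eq\<close>, \<open>normal_form_separated\<close>).
  
  Non-linearity.  Suppose the group consists of matrices; enlarge the field to be algebraically
  closed.  As \<open>a\<close> and \<open>a\<^sup>2\<close> are conjugate, squaring permutes the finitely many eigenvalues of \<open>a\<close>, which
  are therefore roots of unity, and some power \<open>a\<^sup>N\<close> is unipotent (\<open>eventually_unipotent\<close>).  In
  positive characteristic \<open>a\<close> then has finite order.  In characteristic zero put \<open>s = t\<^sup>2\<close>, which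
  conjugates \<open>a\<close> to \<open>a\<^sup>2\<close> and \<open>b\<close> to \<open>b\<^sup>2\<close>.  For unipotent \<open>u\<close> with \<open>s u s\<inverse> = u\<^sup>2\<close> the matrix \<open>u\<^sup>q\<close> is a
  polynomial in \<open>q\<close>, and comparing the coefficients of \<open>s u\<^sup>q s\<inverse>\<close> and \<open>u\<^sup>2\<^sup>q\<close> shows that \<open>s\<close> scales the
  coefficient of \<open>q\<^sup>j\<close> by \<open>2\<^sup>j\<close>.  Hence \<open>u - 1\<close> is a sum of eigenvectors of conjugation by \<open>s\<close> with
  eigenvalues \<open>2\<^sup>j\<close>, \<open>j > 0\<close>.  These weights add up under multiplication and only finitely many of them
  occur, so \<open>a\<^sup>N - 1\<close> and \<open>b\<^sup>N - 1\<close> generate a nilpotent algebra, and \<open>a\<^sup>N\<close>, \<open>b\<^sup>N\<close> satisfy a semigroup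
  identity that holds in nilpotent groups (\<open>thue_morse_collapse\<close>).  In the group itself that identity
  fails, because its two sides move a positive vector to opposite sides of the diagonal
  (\<open>thue_morse_words_distinct\<close>).
\<close>

section \<open>Thue-Morse words\<close>

text \<open>
  The identity \<open>thue_morse f n u v = thue_morse f n v u\<close> is a law, free of inverses, of the nilpotent
  groups of class at most \<open>n\<close>: passing to \<open>n + 1\<close> replaces the two sides \<open>x\<close>, \<open>y\<close> by \<open>x y\<close> and \<open>y x\<close>.
  Leaving the operation \<open>f\<close> open lets the same word be read in a group, in a ring and as a composition
  of maps.
\<close>

fun thue_morse :: "('a \<Rightarrow> 'a \<Rightarrow> 'a) \<Rightarrow> nat \<Rightarrow> 'a \<Rightarrow> 'a \<Rightarrow> 'a" where
  "thue_morse f 0 u v = u"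
| "thue_morse f (Suc n) u v = f (thue_morse f n u v) (thue_morse f n v u)"

section \<open>Units and intertwiners in a ring\<close>

definition two_sided_unit :: "'r::ring_1 \<Rightarrow> bool" where
  "two_sided_unit x \<longleftrightarrow> (\<exists>y. x * y = 1 \<and> y * x = 1)"

lemma two_sided_unitI: "x * y = 1 \<Longrightarrow> z * x = 1 \<Longrightarrow> two_sided_unit x"
  unfolding two_sided_unit_def by (metis mult.assoc mult.left_neutral mult.right_neutral)

lemma two_sided_unit_mult:
  assumes "two_sided_unit x" "two_sided_unit y"
  shows "two_sided_unit (x * y)"
proof -
  obtain x' y' where *: "x * x' = 1" "x' * x = 1" "y * y' = 1" "y' * y = 1"
    using assms by (auto simp: two_sided_unit_def)
  have "x * y * (y' * x') = x * (y * y') * x'" "y' * x' * (x * y) = y' * (x' * x) * y"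
    by (simp_all only: mult.assoc)
  then show ?thesis using * by (auto intro!: two_sided_unitI)
qed

lemma two_sided_unit_commuting_factor:
  assumes "two_sided_unit (x * y)" "x * y = y * x"
  shows "two_sided_unit x"
proof -
  obtain z where "x * y * z = 1" "z * (x * y) = 1"
    using assms(1) by (auto simp: two_sided_unit_def)
  then have "x * (y * z) = 1" "z * y * x = 1"
    by (simp_all add: mult.assoc flip: assms(2))
  then show ?thesis by (rule two_sided_unitI)
qed

lemma two_sided_unit_mult_eq_0_left:
  assumes "two_sided_unit x" "x * y = 0"
  shows "y = 0"
proof -
  obtain z where "z * x = 1" using assms(1) by (auto simp: two_sided_unit_def)
  then have "y = z * (x * y)" by (simp flip: mult.assoc)
  then show ?thesis using assms(2) by simp
qed

lemma two_sided_unit_mult_eq_0_right: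
  assumes "two_sided_unit x" "y * x = 0"
  shows "y = 0"
proof -
  obtain z where "x * z = 1" using assms(1) by (auto simp: two_sided_unit_def)
  then have "y = y * x * z" by (simp add: mult.assoc)
  then show ?thesis using assms(2) by simp
qed

lemma intertwine_power:
  fixes s :: "'r::monoid_mult"
  assumes "s * x = y * s"
  shows "s * x ^ n = y ^ n * s"
proof (induction n)
  case (Suc n)
  have "s * x ^ Suc n = (s * x) * x ^ n" by (simp add: mult.assoc)
  also have "\<dots> = y * (s * x ^ n)" by (simp add: assms mult.assoc)
  also have "\<dots> = y ^ Suc n * s" by (simp add: Suc.IH mult.assoc)
  finally show ?case .
qed simp

section \<open>Algebras over a field and algebraic elements\<close>

text \<open>
  The structure map \<open>c\<close> embeds the scalars as central elements; a type class could not carry a second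
  type for the scalars.
\<close>

locale unital_algebra =
  fixes c :: "'k::field \<Rightarrow> 'r::ring_1"
  assumes c_add: "c (k + l) = c k + c l"
    and c_mult: "c (k * l) = c k * c l"
    and c_1 [simp]: "c 1 = 1"
    and central: "x * c k = c k * x"
begin

lemma c_0 [simp]: "c 0 = 0"
  using c_add[of 0 0] by simp

lemma c_minus: "c (- k) = - c k"
  using c_add[of k "- k"] by (simp add: eq_neg_iff_add_eq_0 add.commute)

lemma c_diff: "c (k - l) = c k - c l"
  using c_add[of k "- l"] by (simp add: c_minus)

lemma c_sum: "c (sum f A) = (\<Sum>i\<in>A. c (f i))"
  by (induction A rule: infinite_finite_induct) (simp_all add: c_add)

lemma c_commute: "c k * c l = c l * c k"
  by (rule central)

lemma c_left_commute: "c k * (c l * x) = c l * (c k * x)"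
  by (metis central mult.assoc)

lemma central_left: "x * (c k * y) = c k * (x * y)"
  by (metis central mult.assoc)

lemma c_unit: "k \<noteq> 0 \<Longrightarrow> two_sided_unit (c k)"
  by (rule two_sided_unitI[of _ "c (inverse k)" "c (inverse k)"]) (simp_all add: c_mult[symmetric])

text \<open>
  Stated as a fact instead of a sublocale, since the simplification rules of vector spaces collect
  scalars, \<open>c k * (c l * x) = c (k * l) * x\<close>, against the direction in which \<open>c_mult\<close> is used below.
\<close>

lemma vector_space: "vector_space (\<lambda>k x. c k * x)"
  by unfold_locales (simp_all add: distrib_left distrib_right c_add c_mult mult.assoc)

text \<open>
  The value at \<open>x\<close> of the monic polynomial with roots \<open>ls\<close>.  A list of roots replaces the annihilating
  polynomial, because all polynomials that matter here split.
\<close>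

definition split_product :: "'r \<Rightarrow> 'k list \<Rightarrow> 'r" where
  "split_product x ls = prod_list (map (\<lambda>l. x - c l) ls)"

lemma split_product_simps [simp]:
  "split_product x [] = 1"
  "split_product x (l # ls) = (x - c l) * split_product x ls"
  by (simp_all add: split_product_def)

definition split_algebraic :: "'r \<Rightarrow> bool" where
  "split_algebraic x \<longleftrightarrow> (\<exists>ls. split_product x ls = 0)"

lemma split_product_commute: "y * x = x * y \<Longrightarrow> y * split_product x ls = split_product x ls * y"
proof (induction ls)
  case (Cons l ls)
  have "y * (x - c l) = (x - c l) * y"
    using Cons.prems by (simp add: algebra_simps central[of y])
  then have "y * split_product x (l # ls) = (x - c l) * (y * split_product x ls)"
    by (metis mult.assoc split_product_simps(2))
  then show ?case using Cons by (simp add: mult.assoc)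
qed simp

text \<open>
  Division of the polynomial with roots \<open>ls\<close> by \<open>X - m\<close>: the remainder \<open>k\<close> is the value at \<open>m\<close>,
  nonzero as \<open>m\<close> is not a root.  Both orders of the factors are recorded to obtain a two-sided inverse
  from it.
\<close>

lemma split_product_division:
  assumes "m \<notin> set ls"
  shows "\<exists>q k. k \<noteq> 0 \<and> split_product x ls = (x - c m) * q + c k
    \<and> split_product x ls = q * (x - c m) + c k"
  using assms
proof (induction ls)
  case Nil
  show ?case by (intro exI[of _ 0] exI[of _ 1]) simp
next
  case (Cons l ls)
  then obtain q k where q: "k \<noteq> 0" "split_product x ls = (x - c m) * q + c k"
    "split_product x ls = q * (x - c m) + c k" by auto
  have comm: "(x - c l) * (x - c m) = (x - c m) * (x - c l)"
    by (simp add: algebra_simps central[of x] c_commute)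
  have rem: "(x - c l) * c k = (x - c m) * c k + c ((m - l) * k)"
    "(x - c l) * c k = c k * (x - c m) + c ((m - l) * k)"
    by (simp_all add: algebra_simps c_mult c_diff central[of x] c_commute)
  let ?q = "(x - c l) * q + c k"
  have "split_product x (l # ls) = (x - c m) * ?q + c ((m - l) * k)"
    by (simp add: q(2) distrib_left rem(1) flip: mult.assoc) (simp add: comm add.assoc)
  moreover have "split_product x (l # ls) = ?q * (x - c m) + c ((m - l) * k)"
    by (simp add: q(3) distrib_left distrib_right rem(2) mult.assoc add.assoc)
  moreover have "(m - l) * k \<noteq> 0" using Cons.prems q(1) by auto
  ultimately show ?case by blast
qed

lemma unit_outside_spectrum:
  assumes "split_product x ls = 0" "m \<notin> set ls"
  shows "two_sided_unit (x - c m)"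
proof -
  obtain q k where q: "k \<noteq> 0" "0 = (x - c m) * q + c k" "0 = q * (x - c m) + c k"
    using split_product_division[OF assms(2), of x] assms(1) by auto
  let ?i = "c (- inverse k)"
  have "(x - c m) * q = - c k" "q * (x - c m) = - c k"
    using q(2,3) by (metis add.commute eq_neg_iff_add_eq_0)+
  then have "(x - c m) * (?i * q) = 1" "(?i * q) * (x - c m) = 1"
    using q(1) by (simp_all add: central_left mult.assoc c_minus c_mult[symmetric])
  then show ?thesis by (rule two_sided_unitI)
qed

text \<open>
  The left factor \<open>y\<close> collects the linear factors already treated by the induction.
\<close>

lemma split_product_drop_units:
  assumes "y * split_product x ls = 0"
    and "\<And>l. l \<in> set ls \<Longrightarrow> \<not> P l \<Longrightarrow> two_sided_unit (x - c l)"
  shows "y * split_product x (filter P ls) = 0"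
  using assms
proof (induction ls arbitrary: y)
  case (Cons l ls)
  show ?case
  proof (cases "P l")
    case True
    then show ?thesis
      using Cons.IH[of "y * (x - c l)"] Cons.prems by (simp add: mult.assoc)
  next
    case False
    have "(x - c l) * x = x * (x - c l)" by (simp add: algebra_simps central[of x])
    then have "y * split_product x ls * (x - c l) = 0"
      using Cons.prems(1) by (simp add: mult.assoc split_product_commute)
    then have "y * split_product x ls = 0"
      using Cons.prems(2)[of l] False by (auto intro: two_sided_unit_mult_eq_0_right)
    then show ?thesis using Cons.IH[of y] Cons.prems(2) False by simp
  qed
qed simp

lemma power_minus_one_factor:
  assumes "l ^ n = (1::'k)"
  shows "\<exists>q. q * x = x * q \<and> x ^ n - 1 = (x - c l) * q"
proof -
  have "\<exists>q. q * x = x * q \<and> x ^ n - c (l ^ n) = (x - c l) * q"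
  proof (induction n)
    case (Suc n)
    then obtain q where q: "q * x = x * q" "x ^ n - c (l ^ n) = (x - c l) * q" by blast
    have "x ^ Suc n - c (l ^ Suc n) = (x - c l) * x ^ n + c l * (x ^ n - c (l ^ n))"
      by (simp add: algebra_simps c_mult)
    also have "\<dots> = (x - c l) * (x ^ n + c l * q)"
      by (simp add: q(2) distrib_left central_left)
    finally show ?case
      using q(1) by (intro exI[of _ "x ^ n + c l * q"])
        (simp add: distrib_left distrib_right central_left mult.assoc power_commutes)
  qed (intro exI[of _ 0], simp)
  then show ?thesis using assms by simp
qed

text \<open>
  Each linear factor \<open>x - c l\<close> divides \<open>x ^ n - 1\<close>, so their product divides \<open>(x ^ n - 1) ^ length ls\<close>.
\<close>

lemma power_minus_one_nilpotent:
  assumes "split_product x ls = 0" "\<And>l. l \<in> set ls \<Longrightarrow> l ^ n = 1"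
  shows "(x ^ n - 1) ^ length ls = 0"
proof -
  have "\<exists>r. (x ^ n - 1) ^ length ls = split_product x ls * r"
    using assms(2)
  proof (induction ls)
    case (Cons l ls)
    then obtain r where r: "(x ^ n - 1) ^ length ls = split_product x ls * r" by auto
    obtain q where q: "q * x = x * q" "x ^ n - 1 = (x - c l) * q"
      using power_minus_one_factor[of l n x] Cons.prems by auto
    have "(x ^ n - 1) ^ length (l # ls) = (x - c l) * (q * split_product x ls) * r"
      by (simp add: r) (simp add: q(2) mult.assoc)
    also have "\<dots> = split_product x (l # ls) * (q * r)"
      by (simp add: split_product_commute[OF q(1)] mult.assoc)
    finally show ?case by blast
  qed (intro exI[of _ 1], simp)
  then show ?thesis using assms(1) by auto
qed

text \<open>
  The spectrum of \<open>a\<close> is finite, omits \<open>0\<close>, and is closed under squaring: \<open>a - c (l\<^sup>2)\<close> is conjugate to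
  \<open>a\<^sup>2 - c (l\<^sup>2) = (a - c l) (a + c l)\<close>.  So every spectral value has repeating iterated squares and is a
  root of unity.  Factors of the annihilating product outside the spectrum are units and can be
  cancelled.
\<close>

lemma eventually_unipotent:
  assumes alg: "split_algebraic a" and a: "two_sided_unit a" and s: "two_sided_unit s"
    and sa: "s * a = a\<^sup>2 * s"
  shows "\<exists>n>0. \<exists>m. (a ^ n - 1) ^ m = 0"
proof -
  define spec where "spec = {l. \<not> two_sided_unit (a - c l)}"
  obtain ls where ls: "split_product a ls = 0" using alg by (auto simp: split_algebraic_def)
  have sub: "spec \<subseteq> set ls"
    using unit_outside_spectrum[OF ls] by (auto simp: spec_def)
  then have fin: "finite spec" using finite_subset by blast
  have sq: "l\<^sup>2 \<in> spec" if "l \<in> spec" for l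
  proof (rule ccontr)
    assume "l\<^sup>2 \<notin> spec"
    then have u: "two_sided_unit (a - c (l\<^sup>2))" by (simp add: spec_def)
    obtain s' where s': "s * s' = 1" "s' * s = 1" using s by (auto simp: two_sided_unit_def)
    have "s * (a - c (l\<^sup>2)) * s' = (a\<^sup>2 * s - c (l\<^sup>2) * s) * s'"
      by (simp only: right_diff_distrib sa central)
    also have "\<dots> = a\<^sup>2 - c (l\<^sup>2)"
      by (simp add: left_diff_distrib mult.assoc s')
    also have "\<dots> = (a - c l) * (a + c l)"
      by (simp add: algebra_simps power2_eq_square c_mult central[of a])
    finally have eq: "s * (a - c (l\<^sup>2)) * s' = (a - c l) * (a + c l)" .
    have "two_sided_unit s'" using s' by (auto simp: two_sided_unit_def)
    then have "two_sided_unit ((a - c l) * (a + c l))"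
      unfolding eq[symmetric] by (intro two_sided_unit_mult s u)
    then have "two_sided_unit (a - c l)"
      by (rule two_sided_unit_commuting_factor) (simp add: algebra_simps central[of a])
    then show False using that by (simp add: spec_def)
  qed
  have nz: "0 \<notin> spec" using a by (simp add: spec_def)
  have root: "\<exists>n>0. l ^ n = 1" if "l \<in> spec" for l
  proof -
    have mem: "l ^ (2 ^ i) \<in> spec" for i :: nat
    proof (induction i)
      case (Suc i)
      then show ?case using sq[OF Suc] by (simp add: mult.commute flip: power_mult)
    qed (use that in simp)
    have "\<not> inj (\<lambda>i::nat. l ^ (2 ^ i))"
      using mem fin by (meson finite_subset image_subset_iff infinite_UNIV_nat range_inj_infinite)
    then obtain i j :: nat where ij: "l ^ (2 ^ i) = l ^ (2 ^ j)" "i < j"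
      unfolding inj_on_def by (metis linorder_neqE_nat)
    have lt: "(2::nat) ^ i < 2 ^ j" using ij(2) by simp
    have l0: "l \<noteq> 0" using that nz by auto
    have "l ^ (2 ^ j - 2 ^ i) * l ^ (2 ^ i) = l ^ (2 ^ j)"
      using lt by (simp only: power_add[symmetric] le_add_diff_inverse2 less_imp_le)
    then have "l ^ (2 ^ j - 2 ^ i) = 1" using l0 ij(1) by simp
    then show ?thesis using lt by (intro exI[of _ "2 ^ j - 2 ^ i"]) simp
  qed
  then obtain e where e: "\<And>l. l \<in> spec \<Longrightarrow> e l > (0::nat) \<and> l ^ e l = 1" by metis
  define n where "n = (\<Prod>l\<in>spec. e l)"
  have "n > 0" using e by (auto simp: n_def intro!: prod_pos)
  have pn: "l ^ n = 1" if "l \<in> spec" for l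
  proof -
    have "e l dvd n" unfolding n_def using fin that by (rule dvd_prodI)
    then show ?thesis using e[OF that] by (auto simp: power_mult)
  qed
  have "split_product a (filter (\<lambda>l. l \<in> spec) ls) = 0"
    using split_product_drop_units[of 1 a ls "\<lambda>l. l \<in> spec"] ls by (simp add: spec_def)
  then have "(a ^ n - 1) ^ length (filter (\<lambda>l. l \<in> spec) ls) = 0"
    by (rule power_minus_one_nilpotent) (use pn in auto)
  then show ?thesis using \<open>n > 0\<close> by blast
qed

section \<open>Powers of unipotent elements\<close>

lemma unipotent_power:
  assumes "z ^ m = 0"
  shows "(1 + z) ^ q = (\<Sum>i<m. c (of_nat (q choose i)) * z ^ i)"
proof (induction q)
  case 0
  show ?case
  proof (cases m)
    case 0
    then have "(1::'r) = 0" using assms by simp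
    then show ?thesis using 0 by simp
  next
    case (Suc m')
    show ?thesis unfolding Suc sum.lessThan_Suc_shift by simp
  qed
next
  case (Suc q)
  let ?f = "\<lambda>q i. c (of_nat (q choose i)) * z ^ i"
  have "(\<Sum>i<m. ?f (Suc q) i) = (\<Sum>i<m. ?f q i) + z * (\<Sum>i<m. ?f q i)"
  proof (cases m)
    case 0
    then show ?thesis by simp
  next
    case (Suc m')
    have "(\<Sum>i<m. ?f (Suc q) i) = 1 + (\<Sum>i<m'. ?f q i * z) + (\<Sum>i<m'. ?f q (Suc i))"
      unfolding Suc sum.lessThan_Suc_shift
      by (simp add: c_add distrib_right sum.distrib mult.assoc power_commutes add.assoc)
    also have "(\<Sum>i<m'. ?f q i * z) = (\<Sum>i<m. ?f q i * z)"
      unfolding Suc sum.lessThan_Suc using assms by (simp add: Suc mult.assoc power_commutes)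
    also have "\<dots> = z * (\<Sum>i<m. ?f q i)"
      by (simp add: sum_distrib_left central_left mult.assoc power_commutes)
    also have "1 + z * (\<Sum>i<m. ?f q i) + (\<Sum>i<m'. ?f q (Suc i))
        = (\<Sum>i<m. ?f q i) + z * (\<Sum>i<m. ?f q i)"
      using sum.lessThan_Suc_shift[of "?f q" m'] by (simp add: Suc del: sum.lessThan_Suc)
    finally show ?thesis .
  qed
  then show ?case by (simp add: Suc.IH[symmetric] distrib_right)
qed

text \<open>
  By \<open>unipotent_power\<close>, \<open>u ^ q\<close> depends only on the residues in \<open>'k\<close> of finitely many binomial
  coefficients.  If the prime ring of \<open>'k\<close> is finite, two powers of \<open>u\<close> must therefore agree.
\<close>

lemma unipotent_torsion:
  fixes u :: 'r
  assumes fin: "finite (range (of_nat :: nat \<Rightarrow> 'k))" and u: "two_sided_unit u" "(u - 1) ^ m = 0"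
  shows "\<exists>n>0. u ^ n = 1"
proof -
  let ?g = "\<lambda>q. restrict (\<lambda>i. of_nat (q choose i) :: 'k) {..<m}"
  have "range ?g \<subseteq> {..<m} \<rightarrow>\<^sub>E range of_nat" by (auto simp: PiE_def extensional_def split: if_splits)
  then have "\<not> inj ?g"
    using fin by (meson finite_PiE finite_lessThan finite_subset range_inj_infinite)
  then obtain q r where qr: "?g q = ?g r" "q < r"
    unfolding inj_on_def by (metis linorder_neqE_nat)
  have "u ^ q = u ^ r"
  proof -
    have "of_nat (q choose i) = (of_nat (r choose i) :: 'k)" if "i < m" for i
      using fun_cong[OF qr(1), of i] that by simp
    then show ?thesis
      using unipotent_power[OF u(2), of q] unipotent_power[OF u(2), of r] by simp
  qed
  moreover have "u ^ r = u ^ q * u ^ (r - q)" using qr(2) by (simp flip: power_add)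
  ultimately have "u ^ q * (u ^ (r - q) - 1) = 0" by (simp add: right_diff_distrib)
  moreover have "two_sided_unit (u ^ q)"
    by (induction q) (auto intro: two_sided_unit_mult u two_sided_unitI[of 1 1 1])
  ultimately have "u ^ (r - q) - 1 = 0" by (blast intro: two_sided_unit_mult_eq_0_left)
  then show ?thesis using qr(2) by (intro exI[of _ "r - q"]) simp
qed


text \<open>
  The assumption \<open>char0\<close> says that \<open>'k\<close> has characteristic zero; as the field is only known to be of
  characteristic zero inside a case distinction, the class \<open>field_char_0\<close> cannot be used.
\<close>

lemma binomial_polynomial:
  assumes char0: "\<And>n. n > 0 \<Longrightarrow> of_nat n \<noteq> (0::'k)"
  shows "\<exists>p. degree p \<le> i \<and> (\<forall>q. poly p (of_nat q) = (of_nat (q choose i) :: 'k))"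
proof (induction i)
  case 0
  show ?case by (intro exI[of _ 1]) simp
next
  case (Suc i)
  then obtain p where p: "degree p \<le> i" "\<And>q. poly p (of_nat q) = (of_nat (q choose i) :: 'k)"
    by blast
  let ?p = "smult (inverse (of_nat (Suc i))) (p * [:- of_nat i, 1:])"
  have "degree (p * [:- of_nat i, 1:]) \<le> i + 1"
    using degree_mult_le[of p "[:- of_nat i, 1:]"] p(1) by simp
  then have "degree ?p \<le> Suc i" by simp
  moreover have "poly ?p (of_nat q) = of_nat (q choose Suc i)" for q
  proof -
    have "of_nat (Suc i) * of_nat (q choose Suc i) = (of_nat (q choose i) * (of_nat q - of_nat i) :: 'k)"
    proof (cases "i \<le> q")
      case True
      have "Suc i * (q choose Suc i) = (q choose i) * (q - i)"
        using binomial_absorb_comp[of q i] binomial_absorption[of i q] by (simp add: mult.commute)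
      then have "of_nat (Suc i * (q choose Suc i)) = (of_nat ((q choose i) * (q - i)) :: 'k)"
        by (rule arg_cong)
      then show ?thesis using True by (simp only: of_nat_mult of_nat_diff)
    qed (simp add: binomial_eq_0)
    then show ?thesis
      using char0[of "Suc i"] by (simp add: p(2) field_simps del: of_nat_Suc)
  qed
  ultimately show ?case by blast
qed

lemma unipotent_power_polynomial:
  assumes char0: "\<And>n. n > 0 \<Longrightarrow> of_nat n \<noteq> (0::'k)" and u: "(u - 1) ^ m = 0"
  shows "\<exists>x. \<forall>q. u ^ q = (\<Sum>j<m. c (of_nat q ^ j) * x j)"
proof -
  obtain p where p: "\<And>i. degree (p i) \<le> i" "\<And>i q. poly (p i) (of_nat q) = (of_nat (q choose i) :: 'k)"
    using binomial_polynomial[OF char0] by metis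
  define x where "x j = (\<Sum>i<m. c (coeff (p i) j) * (u - 1) ^ i)" for j
  have "u ^ q = (\<Sum>j<m. c (of_nat q ^ j) * x j)" for q
  proof -
    have ex: "of_nat (q choose i) = (\<Sum>j<m. coeff (p i) j * of_nat q ^ j)" if "i < m" for i
    proof -
      have "of_nat (q choose i) = (\<Sum>j\<le>degree (p i). coeff (p i) j * of_nat q ^ j)"
        by (simp add: p(2)[symmetric] poly_altdef)
      also have "\<dots> = (\<Sum>j<m. coeff (p i) j * of_nat q ^ j)"
        using p(1)[of i] that by (intro sum.mono_neutral_left) (auto simp: coeff_eq_0)
      finally show ?thesis .
    qed
    have "u ^ q = (\<Sum>i<m. c (of_nat (q choose i)) * (u - 1) ^ i)"
      using unipotent_power[OF u, of q] by simp
    also have "\<dots> = (\<Sum>i<m. \<Sum>j<m. c (of_nat q ^ j) * (c (coeff (p i) j) * (u - 1) ^ i))"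
    proof (rule sum.cong[OF HOL.refl])
      fix i assume "i \<in> {..<m}"
      then have "c (of_nat (q choose i)) = (\<Sum>j<m. c (of_nat q ^ j) * c (coeff (p i) j))"
        by (simp only: ex lessThan_iff c_sum c_mult c_commute)
      then show "c (of_nat (q choose i)) * (u - 1) ^ i
          = (\<Sum>j<m. c (of_nat q ^ j) * (c (coeff (p i) j) * (u - 1) ^ i))"
        by (simp only: sum_distrib_right mult.assoc)
    qed
    also have "\<dots> = (\<Sum>j<m. \<Sum>i<m. c (of_nat q ^ j) * (c (coeff (p i) j) * (u - 1) ^ i))"
      by (rule sum.swap)
    also have "\<dots> = (\<Sum>j<m. c (of_nat q ^ j) * x j)"
      by (simp add: x_def sum_distrib_left)
    finally show ?thesis .
  qed
  then show ?thesis by blast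
qed

text \<open>
  Passing from \<open>P q\<close> to \<open>P (2 q) - 2\<^sup>m P q\<close> kills the coefficient of \<open>q\<^sup>m\<close> and multiplies the lower ones by
  the nonzero numbers \<open>2\<^sup>j - 2\<^sup>m\<close>.
\<close>

lemma polynomial_coefficients_unique:
  assumes char0: "\<And>n. n > 0 \<Longrightarrow> of_nat n \<noteq> (0::'k)"
    and zero: "\<And>q. (\<Sum>j<m. c (of_nat q ^ j) * y j) = 0"
  shows "j < m \<Longrightarrow> y j = 0"
  using zero
proof (induction m arbitrary: y j)
  case (Suc m)
  have low: "y j = 0" if "j < m" for j
  proof -
    have "(\<Sum>j<m. c (of_nat q ^ j) * (c (2 ^ j - 2 ^ m) * y j)) = 0" for q
    proof -
      have "(\<Sum>j<Suc m. c (of_nat (2 * q) ^ j) * y j) 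
          - c (2 ^ m) * (\<Sum>j<Suc m. c (of_nat q ^ j) * y j) = 0"
        by (simp only: Suc.prems(2)) simp
      then have "(\<Sum>j<Suc m. c (of_nat q ^ j) * (c (2 ^ j - 2 ^ m) * y j)) = 0"
        by (simp only: sum_distrib_left flip: sum_subtractf)
          (simp add: c_mult c_diff c_left_commute power_mult_distrib algebra_simps)
      then show ?thesis by simp
    qed
    then have "c (2 ^ j - 2 ^ m) * y j = 0" by (rule Suc.IH[OF that])
    moreover have "(2 ^ j - 2 ^ m :: 'k) \<noteq> 0"
    proof -
      have lt: "(2::nat) ^ j < 2 ^ m" using that by simp
      have "(2 ^ m :: 'k) = of_nat (2 ^ m - 2 ^ j) + 2 ^ j"
        using lt by (simp add: of_nat_diff)
      moreover have "(of_nat (2 ^ m - 2 ^ j) :: 'k) \<noteq> 0" by (rule char0) (use lt in simp)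
      ultimately show ?thesis by auto
    qed
    ultimately show ?thesis using two_sided_unit_mult_eq_0_left[OF c_unit] by blast
  qed
  moreover have "y m = 0" using Suc.prems(2)[of 1] low by simp
  ultimately show ?case using Suc.prems(1) less_Suc_eq by blast
qed simp

section \<open>The weight filtration\<close>

text \<open>
  For invertible \<open>s\<close> this is the eigenspace of conjugation by \<open>s\<close> for the eigenvalue \<open>2 ^ d\<close>.
\<close>

definition weight_space :: "'r \<Rightarrow> nat \<Rightarrow> 'r set" where
  "weight_space s d = {x. s * x = c (2 ^ d) * x * s}"

text \<open>
  Elements of weights at least \<open>d\<close> are added one at a time, so that membership can be used by induction
  without fixing a decomposition into weights.
\<close>

inductive_set weight_filtration :: "'r \<Rightarrow> nat \<Rightarrow> 'r set" for s d where
  zero: "0 \<in> weight_filtration s d"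
| add: "x \<in> weight_space s j \<Longrightarrow> d \<le> j \<Longrightarrow> y \<in> weight_filtration s d \<Longrightarrow> x + y \<in> weight_filtration s d"

lemma weight_space_mult:
  assumes "x \<in> weight_space s i" "y \<in> weight_space s j"
  shows "x * y \<in> weight_space s (i + j)"
proof -
  have x: "s * x = c (2 ^ i) * x * s" and y: "s * y = c (2 ^ j) * y * s"
    using assms by (simp_all only: weight_space_def mem_Collect_eq)
  have "s * (x * y) = (s * x) * y" by (simp only: mult.assoc)
  also have "\<dots> = c (2 ^ i) * (x * (s * y))" by (simp only: x mult.assoc)
  also have "\<dots> = c (2 ^ i) * (c (2 ^ j) * (x * (y * s)))"
    by (simp only: y mult.assoc central_left[of x])
  also have "\<dots> = c (2 ^ (i + j)) * (x * y) * s"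
    by (simp only: power_add c_mult mult.assoc)
  finally show ?thesis by (simp add: weight_space_def)
qed

lemma weight_filtration_add:
  "x \<in> weight_filtration s d \<Longrightarrow> y \<in> weight_filtration s d \<Longrightarrow> x + y \<in> weight_filtration s d"
  by (induction rule: weight_filtration.induct)
    (auto simp: add.assoc intro: weight_filtration.intros)

lemma weight_space_uminus: "x \<in> weight_space s d \<Longrightarrow> - x \<in> weight_space s d"
  by (simp add: weight_space_def)

lemma weight_filtration_uminus: "x \<in> weight_filtration s d \<Longrightarrow> - x \<in> weight_filtration s d"
proof (induction rule: weight_filtration.induct)
  case (add x j y)
  then have "- x + - y \<in> weight_filtration s d"
    by (intro weight_filtration.add weight_space_uminus)
  then show ?case by simp
qed (simp add: weight_filtration.zero)

lemma weight_filtration_diff: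
  "x \<in> weight_filtration s d \<Longrightarrow> y \<in> weight_filtration s d \<Longrightarrow> x - y \<in> weight_filtration s d"
  using weight_filtration_add[OF _ weight_filtration_uminus, of x s d y] by simp

lemma weight_filtration_antimono:
  "x \<in> weight_filtration s e \<Longrightarrow> d \<le> e \<Longrightarrow> x \<in> weight_filtration s d"
  by (induction rule: weight_filtration.induct) (auto intro: weight_filtration.intros)

lemma weight_filtration_sum:
  "(\<And>i. i \<in> A \<Longrightarrow> f i \<in> weight_filtration s d) \<Longrightarrow> sum f A \<in> weight_filtration s d"
  by (induction A rule: infinite_finite_induct)
    (auto intro: weight_filtration.zero weight_filtration_add)

lemma weight_space_filtration: "x \<in> weight_space s d \<Longrightarrow> x \<in> weight_filtration s d"
  using weight_filtration.add[of x s d d 0] by (simp add: weight_filtration.zero)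

lemma weight_filtration_mult:
  assumes "x \<in> weight_filtration s d" "y \<in> weight_filtration s e"
  shows "x * y \<in> weight_filtration s (d + e)"
  using assms(1)
proof (induction rule: weight_filtration.induct)
  case (add x j z)
  have "x * y \<in> weight_filtration s (d + e)" using assms(2)
  proof (induction rule: weight_filtration.induct)
    case (add y k w)
    then have "x * y \<in> weight_space s (j + k)"
      using \<open>x \<in> weight_space s j\<close> by (intro weight_space_mult)
    then show ?case
      using add \<open>d \<le> j\<close> by (auto simp: distrib_left intro: weight_filtration.add)
  qed (simp add: weight_filtration.zero)
  then show ?case using add by (simp add: distrib_right weight_filtration_add)
qed (simp add: weight_filtration.zero)

text \<open>
  Write \<open>u ^ q\<close> as a polynomial in \<open>q\<close> with coefficients \<open>x j\<close>.  Since \<open>s * u ^ q = u ^ (2 * q) * s\<close>, uniqueness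
  of coefficients gives \<open>s * x j = 2 ^ j * x j * s\<close>.  The values at \<open>q = 0\<close> and \<open>q = 1\<close> give \<open>x 0 = 1\<close> and
  that \<open>u\<close> is the sum of all \<open>x j\<close>.
\<close>

lemma unipotent_in_weight_filtration:
  assumes char0: "\<And>n. n > 0 \<Longrightarrow> of_nat n \<noteq> (0::'k)" and u: "(u - 1) ^ m = 0"
    and su: "s * u = u\<^sup>2 * s"
  shows "u - 1 \<in> weight_filtration s 1"
proof -
  obtain x where x: "\<And>q. u ^ q = (\<Sum>j<m. c (of_nat q ^ j) * x j)"
    using unipotent_power_polynomial[OF char0 u] by blast
  have weight: "x j \<in> weight_space s j" if "j < m" for j
  proof -
    have zero: "(\<Sum>j<m. c (of_nat q ^ j) * (s * x j - c (2 ^ j) * x j * s)) = 0" for q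
    proof -
      have "s * u ^ q = u ^ (2 * q) * s"
        using intertwine_power[OF su, of q] by (simp add: power_mult)
      then have "s * (\<Sum>j<m. c (of_nat q ^ j) * x j) - (\<Sum>j<m. c (of_nat (2 * q) ^ j) * x j) * s = 0"
        by (simp only: x) simp
      then show ?thesis
        by (simp only: sum_distrib_left sum_distrib_right flip: sum_subtractf)
          (simp add: central_left[of s] mult.assoc right_diff_distrib c_mult power_mult_distrib c_left_commute)
    qed
    have "s * x j - c (2 ^ j) * x j * s = 0"
      by (rule polynomial_coefficients_unique[where y = "\<lambda>j. s * x j - c (2 ^ j) * x j * s"])
        (fact char0 zero that)+
    then show ?thesis by (simp add: weight_space_def)
  qed
  show ?thesis
  proof (cases m)
    case 0
    then have "(1::'r) = 0" using u by simp
    then have "u - 1 = 0" by (metis mult_1 mult_zero_left)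
    then show ?thesis by (simp add: weight_filtration.zero)
  next
    case (Suc m')
    have "x 0 = 1" using x[of 0] by (simp add: Suc sum.lessThan_Suc_shift power_0_left del: sum.lessThan_Suc)
    moreover have "u = (\<Sum>j<m. x j)" using x[of 1] by simp
    ultimately have "u - 1 = (\<Sum>j<m'. x (Suc j))"
      by (simp add: Suc sum.lessThan_Suc_shift del: sum.lessThan_Suc)
    moreover have "x (Suc j) \<in> weight_filtration s 1" if "j < m'" for j
      using weight_space_filtration[OF weight[of "Suc j"]] that
      by (auto simp: Suc intro: weight_filtration_antimono)
    ultimately show ?thesis by (auto intro: weight_filtration_sum)
  qed
qed

lemma weight_space_intertwine_split_product:
  assumes "x \<in> weight_space s d"
  shows "split_product s ls * x = x * prod_list (map (\<lambda>l. c (2 ^ d) * s - c l) ls)"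
proof (induction ls)
  case (Cons l ls)
  let ?P = "prod_list (map (\<lambda>l. c (2 ^ d) * s - c l) ls)"
  have "(s - c l) * x = x * (c (2 ^ d) * s - c l)"
    using assms by (simp add: weight_space_def left_diff_distrib right_diff_distrib central[of x]
        mult.assoc central_left[of x])
  then show ?case by (simp add: Cons.IH mult.assoc) (simp flip: mult.assoc)
qed simp

text \<open>
  For \<open>x\<close> of weight \<open>d\<close>, moving the annihilating product of \<open>s\<close> across \<open>x\<close> gives
  \<open>0 = x (2\<^sup>d s - l\<^sub>1) \<dots> (2\<^sup>d s - l\<^sub>k)\<close>.  A factor is a unit unless \<open>l\<^sub>i / 2\<^sup>d\<close> is again one of the \<open>l\<close>s, which for
  nonzero \<open>l\<^sub>i\<close> happens for finitely many \<open>d\<close> only.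
\<close>

lemma high_weight_spaces_trivial:
  assumes char0: "\<And>n. n > 0 \<Longrightarrow> of_nat n \<noteq> (0::'k)"
    and alg: "split_algebraic s" and s: "two_sided_unit s"
  shows "\<exists>D. \<forall>d\<ge>D. weight_space s d \<subseteq> {0}"
proof -
  obtain ls where ls: "split_product s ls = 0" using alg by (auto simp: split_algebraic_def)
  have two: "(2::'k) \<noteq> 0" using char0[of 2] by simp
  \<comment> \<open>for l = 0 the factor is a multiple of s, hence a unit for every d\<close>
  define bad where "bad = {d::nat. \<exists>l\<in>set ls. l \<noteq> 0 \<and> l / 2 ^ d \<in> set ls}"
  have inj2: "i = j" if "(2::'k) ^ i = 2 ^ j" for i j :: nat
  proof (rule ccontr)
    assume "i \<noteq> j"
    then have "(2::nat) ^ i \<noteq> 2 ^ j" by simp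
    then consider "(2::nat) ^ i < 2 ^ j" | "(2::nat) ^ j < 2 ^ i" by linarith
    then show False
    proof cases
      case 1
      then have "(of_nat (2 ^ j - 2 ^ i) :: 'k) = 0" using that by (simp add: of_nat_diff)
      then show False using char0[of "2 ^ j - 2 ^ i"] 1 by simp
    next
      case 2
      then have "(of_nat (2 ^ i - 2 ^ j) :: 'k) = 0" using that by (simp add: of_nat_diff)
      then show False using char0[of "2 ^ i - 2 ^ j"] 2 by simp
    qed
  qed
  have "finite bad"
  proof -
    have "finite {d::nat. l / 2 ^ d \<in> set ls}" if "l \<noteq> 0" for l
    proof (rule finite_imageD)
      show "finite ((\<lambda>d. l / 2 ^ d) ` {d. l / 2 ^ d \<in> set ls})"
        by (rule finite_subset[of _ "set ls"]) auto
      show "inj_on (\<lambda>d. l / 2 ^ d) {d. l / 2 ^ d \<in> set ls}"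
        using that two by (auto simp: inj_on_def intro!: inj2)
    qed
    then have "finite (\<Union>l\<in>set ls - {0}. {d::nat. l / 2 ^ d \<in> set ls})" by blast
    moreover have "bad = (\<Union>l\<in>set ls - {0}. {d. l / 2 ^ d \<in> set ls})" by (auto simp: bad_def)
    ultimately show ?thesis by simp
  qed
  then obtain D where D: "\<And>d. d \<in> bad \<Longrightarrow> d < D" using finite_nat_set_iff_bounded by auto
  have "x = 0" if d: "d \<ge> D" and x: "x \<in> weight_space s d" for d x
  proof -
    have unit: "two_sided_unit (c (2 ^ d) * s - c l)" if "l \<in> set ls" for l
    proof -
      have u: "two_sided_unit (s - c (l / 2 ^ d))"
      proof (cases "l = 0")
        case False
        have "l / 2 ^ d \<notin> set ls" using D[of d] d that False by (auto simp: bad_def)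
        then show ?thesis by (rule unit_outside_spectrum[OF ls])
      qed (simp add: s)
      have "c (2 ^ d) * s - c l = c (2 ^ d) * (s - c (l / 2 ^ d))"
        using two by (simp add: right_diff_distrib c_mult[symmetric])
      then show ?thesis using two u by (simp add: two_sided_unit_mult c_unit)
    qed
    then have "two_sided_unit (prod_list (map (\<lambda>l. c (2 ^ d) * s - c l) ls'))"
      if "set ls' \<subseteq> set ls" for ls'
      using that by (induction ls') (auto intro: two_sided_unit_mult two_sided_unitI[of 1 1 1])
    then show ?thesis
      using weight_space_intertwine_split_product[OF x, of ls] ls
      by (auto intro: two_sided_unit_mult_eq_0_right)
  qed
  then show ?thesis by blast
qed

lemma weight_filtration_trivial:
  assumes "x \<in> weight_filtration s d" "\<And>e. e \<ge> d \<Longrightarrow> weight_space s e \<subseteq> {0}"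
  shows "x = 0"
  using assms by induction auto

lemma thue_morse_minus_one_in_filtration:
  assumes "u - 1 \<in> weight_filtration s 1" "v - 1 \<in> weight_filtration s 1"
  shows "thue_morse (*) n u v - 1 \<in> weight_filtration s 1"
  using assms
proof (induction n arbitrary: u v)
  case (Suc n)
  let ?x = "thue_morse (*) n u v - 1" and ?y = "thue_morse (*) n v u - 1"
  have "?x * ?y \<in> weight_filtration s 1"
    using weight_filtration_mult[of ?x s 1 ?y 1] Suc by (auto intro: weight_filtration_antimono)
  then have "?x * ?y + (?x + ?y) \<in> weight_filtration s 1"
    using Suc by (intro weight_filtration_add) auto
  moreover have "?x * ?y + (?x + ?y) = thue_morse (*) (Suc n) u v - 1"
    by (simp add: left_diff_distrib right_diff_distrib)
  ultimately show ?case by simp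
qed simp

text \<open>
  Let \<open>d\<close> be the difference of the two words at stage \<open>n\<close>, and \<open>y\<close> the second of them.  The difference
  at stage \<open>n + 1\<close> is \<open>(y + d) y - y (y + d) = d y - y d\<close>, which is the commutator of \<open>d\<close> and \<open>y - 1\<close>; so each stage
  raises the weight by at least one.
\<close>

lemma thue_morse_difference_in_filtration:
  assumes "u - 1 \<in> weight_filtration s 1" "v - 1 \<in> weight_filtration s 1"
  shows "thue_morse (*) n u v - thue_morse (*) n v u \<in> weight_filtration s (Suc n)"
proof (induction n)
  case 0
  show ?case using weight_filtration_diff[OF assms] by simp
next
  case (Suc n)
  let ?d = "thue_morse (*) n u v - thue_morse (*) n v u" and ?y = "thue_morse (*) n v u - 1"
  have y: "?y \<in> weight_filtration s 1"
    by (rule thue_morse_minus_one_in_filtration[OF assms(2,1)])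
  have "?d * ?y - ?y * ?d \<in> weight_filtration s (Suc (Suc n))"
    using weight_filtration_mult[OF Suc y] weight_filtration_mult[OF y Suc]
    by (intro weight_filtration_diff) simp_all
  then show ?case by (simp add: algebra_simps)
qed

text \<open>
  In positive characteristic a common power of \<open>a\<close> and its conjugate \<open>b\<close> is \<open>1\<close>; in characteristic zero the
  difference of the two Thue-Morse words has a weight beyond all weights that occur.
\<close>

theorem thue_morse_collapse:
  assumes a: "split_algebraic a" "two_sided_unit a"
    and t: "split_algebraic (t * t)" "two_sided_unit t"
    and ta: "t * a = b * t" and tb: "t * b = a\<^sup>2 * t"
  shows "\<exists>N>0. \<exists>n. thue_morse (*) n (a ^ N) (b ^ N) = thue_morse (*) n (b ^ N) (a ^ N)"
proof -
  let ?s = "t * t"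
  have s: "two_sided_unit ?s" by (rule two_sided_unit_mult[OF t(2) t(2)])
  have sa: "?s * a = a\<^sup>2 * ?s" 
    by (metis ta tb mult.assoc)
  have sb: "?s * b = b\<^sup>2 * ?s"
  proof -
    have "?s * b = t * a\<^sup>2 * t" by (simp add: mult.assoc tb)
    also have "\<dots> = b\<^sup>2 * ?s" using intertwine_power[OF ta, of 2] by (simp add: mult.assoc)
    finally show ?thesis .
  qed
  obtain N m where N: "N > 0" "(a ^ N - 1) ^ m = 0"
    using eventually_unipotent[OF a s sa] by blast
  have tp: "t * a ^ M = b ^ M * t" for M by (rule intertwine_power[OF ta])
  have conj: "t * (a ^ N - 1) = (b ^ N - 1) * t"
    by (simp add: algebra_simps tp)
  have "(b ^ N - 1) ^ m * t = 0" using intertwine_power[OF conj, of m] N(2) by simp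
  then have bN: "(b ^ N - 1) ^ m = 0" by (rule two_sided_unit_mult_eq_0_right[OF t(2)])
  show ?thesis
  proof (cases "\<exists>n>0. of_nat n = (0::'k)")
    case True
    then obtain p where p: "p > 0" "of_nat p = (0::'k)" by blast
    have "of_nat n = (of_nat (n mod p) :: 'k)" for n
    proof -
      have "(of_nat n :: 'k) = of_nat (p * (n div p) + n mod p)" by simp
      also have "\<dots> = of_nat (n mod p)" by (simp only: of_nat_add of_nat_mult p(2)) simp
      finally show ?thesis .
    qed
    then have "range (of_nat :: nat \<Rightarrow> 'k) \<subseteq> of_nat ` {..<p}"
      using p(1) by (metis image_subsetI imageI lessThan_iff mod_less_divisor)
    then have fin: "finite (range (of_nat :: nat \<Rightarrow> 'k))" using finite_subset by blast
    have "two_sided_unit (a ^ N)"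
      by (induction N) (auto intro: two_sided_unit_mult a two_sided_unitI[of 1 1 1])
    then obtain M where M: "M > 0" "(a ^ N) ^ M = 1"
      using unipotent_torsion[OF fin _ N(2)] by blast
    have a1: "a ^ (N * M) = 1" using M(2) by (simp add: power_mult)
    then have "(b ^ (N * M) - 1) * t = 0"
      using tp[of "N * M"] by (simp add: left_diff_distrib)
    then have "b ^ (N * M) - 1 = 0" by (rule two_sided_unit_mult_eq_0_right[OF t(2)])
    then have "thue_morse (*) 0 (a ^ (N * M)) (b ^ (N * M)) = thue_morse (*) 0 (b ^ (N * M)) (a ^ (N * M))"
      using a1 by simp
    then show ?thesis using N(1) M(1) by (meson nat_0_less_mult_iff)
  next
    case False
    then have char0: "of_nat n \<noteq> (0::'k)" if "n > 0" for n using that by blast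
    have fa: "a ^ N - 1 \<in> weight_filtration ?s 1"
      using N(2) intertwine_power[OF sa, of N]
      by (intro unipotent_in_weight_filtration[OF char0]) (auto simp: mult.commute simp flip: power_mult)
    have fb: "b ^ N - 1 \<in> weight_filtration ?s 1"
      using bN intertwine_power[OF sb, of N]
      by (intro unipotent_in_weight_filtration[OF char0]) (auto simp: mult.commute simp flip: power_mult)
    obtain D where D: "\<And>d. d \<ge> D \<Longrightarrow> weight_space ?s d \<subseteq> {0}"
      using high_weight_spaces_trivial[OF char0 t(1) s] by blast
    have "thue_morse (*) D (a ^ N) (b ^ N) - thue_morse (*) D (b ^ N) (a ^ N) = 0"
      by (rule weight_filtration_trivial[OF thue_morse_difference_in_filtration[OF fa fb, of D] D]) simp
    then show ?thesis using N(1) by auto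
  qed
qed

end


text \<open>
  The powers of \<open>x\<close> are linearly dependent, which gives an annihilating polynomial, and this splits over
  an algebraically closed field.
\<close>

lemma split_algebraic_if_powers_in_finite_span:
  fixes c :: "'k::alg_closed_field \<Rightarrow> 'r::ring_1"
  assumes alg: "unital_algebra c" and B: "finite B"
    and span: "\<And>i. x ^ i \<in> module.span (\<lambda>k x. c k * x) B"
  shows "unital_algebra.split_algebraic c x"
proof -
  interpret unital_algebra c by (rule alg)
  interpret vs: vector_space "\<lambda>k x. c k * x" by (rule vector_space)
  have "\<exists>I u. finite I \<and> (\<Sum>i\<in>I. c (u i) * x ^ i) = 0 \<and> (\<exists>i\<in>I. u i \<noteq> 0)"
  proof (cases "inj (\<lambda>i. x ^ i)")
    case True
    have "vs.dependent (range (\<lambda>i. x ^ i))"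
    proof (rule ccontr)
      assume "vs.independent (range (\<lambda>i. x ^ i))"
      then have "finite (range (\<lambda>i. x ^ i))"
        using vs.independent_span_bound[OF B, of "range (\<lambda>i. x ^ i)"] span by auto
      then show False using True finite_imageD by blast
    qed
    then obtain T u where T: "finite T" "T \<subseteq> range (\<lambda>i. x ^ i)" "(\<Sum>v\<in>T. c (u v) * v) = 0"
        "\<exists>v\<in>T. u v \<noteq> 0"
      unfolding vs.dependent_explicit by auto
    obtain I where I: "T = (\<lambda>i. x ^ i) ` I" "finite I"
      using T(1,2) by (metis finite_subset_image)
    have "(\<Sum>i\<in>I. c (u (x ^ i)) * x ^ i) = 0"
      using T(3) True unfolding I(1) by (subst (asm) sum.reindex) (auto intro: inj_on_subset)
    then show ?thesis using T(4) I by (intro exI[of _ I] exI[of _ "\<lambda>i. u (x ^ i)"]) auto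
  next
    case False
    then obtain i j where "x ^ i = x ^ j" "i \<noteq> j" by (auto simp: inj_def)
    then show ?thesis
      by (intro exI[of _ "{i, j}"] exI[of _ "\<lambda>k. if k = i then 1 else - 1"]) (simp add: c_minus)
  qed
  then obtain I u where I: "finite I" "(\<Sum>i\<in>I. c (u i) * x ^ i) = 0" "\<exists>i\<in>I. u i \<noteq> 0"
    by blast
  \<comment> \<open>evaluation of polynomials at x; the target ring need not be commutative\<close>
  define ev where "ev p = fold_coeffs (\<lambda>k y. c k + x * y) p 0" for p
  have ev_pCons: "ev (pCons k p) = c k + x * ev p" for k p
    by (cases "p = 0 \<and> k = 0") (auto simp: ev_def)
  have ev_0: "ev 0 = 0" by (simp add: ev_def)
  have ev_add: "ev (p + q) = ev p + ev q" for p q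
    by (induction p q rule: poly_induct2) (simp_all add: ev_0 ev_pCons c_add algebra_simps)
  have ev_monom: "ev (monom k i) = c k * x ^ i" for k i
    by (induction i) (simp_all add: monom_0 monom_Suc ev_0 ev_pCons central_left[of x])
  have ev_smult: "ev (smult k p) = c k * ev p" for k p
    by (induction p) (simp_all add: ev_0 ev_pCons c_mult c_commute algebra_simps central_left[of x])
  have ev_linear: "ev ([:- l, 1:] * p) = (x - c l) * ev p" for l p
  proof -
    have "[:- l, 1:] * p = smult (- l) p + pCons 0 p" by simp
    then have "ev ([:- l, 1:] * p) = ev (smult (- l) p) + ev (pCons 0 p)" by (simp only: ev_add)
    also have "\<dots> = (x - c l) * ev p"
      by (simp only: ev_smult ev_pCons) (simp add: c_minus left_diff_distrib)
    finally show ?thesis .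
  qed
  define p where "p = (\<Sum>i\<in>I. monom (u i) i)"
  have "ev p = (\<Sum>i\<in>I. c (u i) * x ^ i)"
    unfolding p_def using I(1) by (induction I) (simp_all add: ev_0 ev_add ev_monom)
  then have ev_p: "ev p = 0" using I(2) by simp
  have "p \<noteq> 0"
  proof
    assume "p = 0"
    obtain i where i: "i \<in> I" "u i \<noteq> 0" using I(3) by blast
    have "coeff p i = (\<Sum>j\<in>I. if j = i then u i else 0)"
      unfolding p_def coeff_sum by (rule sum.cong) auto
    also have "\<dots> = u i" using I(1) i(1) by simp
    finally show False using i(2) \<open>p = 0\<close> by simp
  qed
  then obtain A where A: "p = smult (lead_coeff p) (\<Prod>l\<in>#A. [:- l, 1:])"
    using alg_closed_imp_factorization by blast
  obtain ls where ls: "mset ls = A" using ex_mset by blast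
  have "ev (prod_list (map (\<lambda>l. [:- l, 1:]) ls)) = split_product x ls"
    by (induction ls) (simp_all add: ev_linear one_pCons ev_pCons ev_0 del: mult_pCons_left)
  moreover have "(\<Prod>l\<in>#A. [:- l, 1:]) = prod_list (map (\<lambda>l. [:- l, 1:]) ls)"
    by (simp only: ls[symmetric] mset_map[symmetric] prod_mset_prod_list)
  ultimately have "c (lead_coeff p) * split_product x ls = 0"
    using ev_p A ev_smult by metis
  moreover have "two_sided_unit (c (lead_coeff p))"
    by (rule c_unit) (use \<open>p \<noteq> 0\<close> in simp)
  ultimately have "split_product x ls = 0" by (metis two_sided_unit_mult_eq_0_left)
  then show ?thesis by (auto simp: split_algebraic_def)
qed


section \<open>An action on quadruples of integers and its reductions\<close>

type_synonym point = "int \<times> int \<times> int \<times> int"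

text \<open>
  The maps by which \<open>a\<^sup>k\<close>, \<open>b\<^sup>k\<close> and \<open>t\<inverse>\<close> act.  The coordinates \<open>p\<close>, \<open>q\<close> are parameters of the two
  elementary matrices acting on \<open>(u, v)\<close>.  Exchanging the roles of the two matrices while doubling one
  parameter is what turns \<open>a\<close> into \<open>b\<close> and \<open>b\<close> into \<open>a\<^sup>2\<close> under conjugation by \<open>t\<close>.
\<close>

fun shear :: "int \<Rightarrow> point \<Rightarrow> point" where
  "shear k (p, q, u, v) = (p, q, u + k * p * v, v)"

fun coshear :: "int \<Rightarrow> point \<Rightarrow> point" where
  "coshear k (p, q, u, v) = (p, q, u, v + k * q * u)"

fun turn :: "point \<Rightarrow> point" where
  "turn (p, q, u, v) = (q, 2 * p, v, u)"

text \<open>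
  The inverse of \<open>turn\<close> modulo an odd \<open>N\<close>, where \<open>(N + 1) div 2\<close> is the inverse of \<open>2\<close>.
\<close>

fun unturn :: "int \<Rightarrow> point \<Rightarrow> point" where
  "unturn N (p, q, u, v) = ((N + 1) div 2 * q, p, v, u)"

fun reduce :: "int \<Rightarrow> point \<Rightarrow> point" where
  "reduce N (p, q, u, v) = (p mod N, q mod N, u mod N, v mod N)"

definition residue_box :: "int \<Rightarrow> point set" where
  "residue_box N = {0..<N} \<times> {0..<N} \<times> {0..<N} \<times> {0..<N}"

definition periodic :: "int \<Rightarrow> (point \<Rightarrow> point) \<Rightarrow> bool" where
  "periodic N f \<longleftrightarrow> (\<forall>x. reduce N (f (reduce N x)) = reduce N (f x))"

text \<open>
  The map on residues, extended by the identity to all points since a permutation of a set is a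
  function on the whole type that fixes the points outside.
\<close>

definition induced :: "int \<Rightarrow> (point \<Rightarrow> point) \<Rightarrow> point \<Rightarrow> point" where
  "induced N f x = (if x \<in> residue_box N then reduce N (f x) else x)"

lemma finite_box: "finite (residue_box N)"
  by (simp add: residue_box_def)

lemma reduce_in_box: "N > 0 \<Longrightarrow> reduce N x \<in> residue_box N"
  by (cases x) (simp add: residue_box_def)

lemma reduce_box: "x \<in> residue_box N \<Longrightarrow> reduce N x = x"
  by (cases x) (simp add: residue_box_def)

lemma periodicI: "(\<And>p q u v. reduce N (f (p mod N, q mod N, u mod N, v mod N)) = reduce N (f (p, q, u, v)))
  \<Longrightarrow> periodic N f"
  by (auto simp: periodic_def)

lemma periodicD: "periodic N f \<Longrightarrow> reduce N (f (reduce N x)) = reduce N (f x)"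
  by (simp only: periodic_def)

lemma periodic_shear: "periodic N (shear k)"
  by (rule periodicI, simp) (intro allI mod_add_cong mod_mult_cong; simp)

lemma periodic_coshear: "periodic N (coshear k)"
  by (rule periodicI, simp) (intro allI mod_add_cong mod_mult_cong; simp)

lemma periodic_turn: "periodic N turn"
  by (rule periodicI) (simp add: mod_simps)

lemma periodic_unturn: "periodic N (unturn N)"
  by (rule periodicI) (simp add: mod_simps)

lemma periodic_comp: "periodic N f \<Longrightarrow> periodic N g \<Longrightarrow> periodic N (f \<circ> g)"
  unfolding periodic_def comp_def by metis

lemma periodic_id: "periodic N id"
  by (simp add: periodic_def)

lemma induced_reduce: "N > 0 \<Longrightarrow> periodic N f \<Longrightarrow> induced N f (reduce N x) = reduce N (f x)"
  by (simp add: induced_def reduce_in_box periodicD)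

lemma induced_comp:
  "N > 0 \<Longrightarrow> periodic N f \<Longrightarrow> induced N f \<circ> induced N g = induced N (f \<circ> g)"
  by (rule ext) (simp add: induced_def reduce_in_box periodicD)

lemma induced_cong: "(\<And>x. reduce N (f x) = reduce N (g x)) \<Longrightarrow> induced N f = induced N g"
  by (rule ext) (simp add: induced_def)

lemma induced_id: "induced N id = id"
  by (rule ext) (simp add: induced_def reduce_box)

lemma induced_permutes:
  assumes "induced N f \<circ> induced N g = id" "induced N g \<circ> induced N f = id"
  shows "induced N f permutes residue_box N"
proof -
  have "bij (induced N f)" by (rule o_bij[OF assms(2,1)])
  then show ?thesis
    unfolding permutes_def by (auto simp: induced_def bij_iff)
qed

definition perm_group :: "'a set \<Rightarrow> ('a \<Rightarrow> 'a) monoid" where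
  "perm_group S = \<lparr>carrier = {p. p permutes S}, mult = (\<circ>), one = id\<rparr>"

lemma perm_group_simps [simp]:
  "carrier (perm_group S) = {p. p permutes S}" "mult (perm_group S) = (\<circ>)" "one (perm_group S) = id"
  by (simp_all add: perm_group_def)

lemma group_perm_group: "group (perm_group S)"
proof (rule groupI)
  fix x assume "x \<in> carrier (perm_group S)"
  then show "\<exists>y\<in>carrier (perm_group S). y \<otimes>\<^bsub>perm_group S\<^esub> x = \<one>\<^bsub>perm_group S\<^esub>"
    by (intro bexI[of _ "inv_into UNIV x"]) (auto simp: permutes_inv permutes_inv_o)
qed (auto simp: permutes_compose permutes_id comp_assoc)

lemma two_half: "odd (N::int) \<Longrightarrow> (N + 1) div 2 * (2 * x) mod N = x mod N"
proof -
  assume "odd N"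
  then have "(N + 1) div 2 * (2 * x) = x + N * x" by (auto elim!: oddE simp: algebra_simps)
  then show ?thesis by simp
qed

lemma turn_unturn:
  assumes "N > 0" "odd N"
  shows "induced N turn \<circ> induced N (unturn N) = id" "induced N (unturn N) \<circ> induced N turn = id"
proof -
  have "reduce N ((turn \<circ> unturn N) x) = reduce N (id x)" for x
    using two_half[OF assms(2)] by (cases x) (simp add: mult.left_commute)
  then show "induced N turn \<circ> induced N (unturn N) = id"
    using induced_cong[of N "turn \<circ> unturn N" id] assms
    by (simp add: induced_comp periodic_turn induced_id)
  have "reduce N ((unturn N \<circ> turn) x) = reduce N (id x)" for x
    using two_half[OF assms(2)] by (cases x) simp
  then show "induced N (unturn N) \<circ> induced N turn = id"
    using induced_cong[of N "unturn N \<circ> turn" id] assms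
    by (simp add: induced_comp periodic_unturn induced_id)
qed

lemma shear_add: "shear k \<circ> shear l = shear (k + l)"
  by (rule ext) (auto simp: algebra_simps)

lemma coshear_add: "coshear k \<circ> coshear l = coshear (k + l)"
  by (rule ext) (auto simp: algebra_simps)

lemma shear_0: "shear 0 = id" and coshear_0: "coshear 0 = id"
  by (rule ext; auto)+

lemma shear_permutes: "N > 0 \<Longrightarrow> induced N (shear k) permutes residue_box N"
  by (rule induced_permutes[of _ _ "shear (- k)"])
    (simp_all add: induced_comp periodic_shear shear_add shear_0 induced_id)

lemma unturn_shear_turn:
  assumes "N > 0" "odd N"
  shows "induced N (unturn N) \<circ> induced N (shear k) \<circ> induced N turn = induced N (coshear k)"
proof -
  have "reduce N ((unturn N \<circ> shear k \<circ> turn) x) = reduce N (coshear k x)" for x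
    using two_half[OF assms(2)] by (cases x) simp
  then have "induced N (unturn N \<circ> shear k \<circ> turn) = induced N (coshear k)" by (rule induced_cong)
  then show ?thesis
    using assms by (simp add: induced_comp periodic_unturn periodic_shear periodic_comp)
qed

text \<open>
  Together with the previous lemma this is the relation \<open>t\<^sup>2 a t\<^sup>-\<^sup>2 = a\<^sup>2\<close> for the action.
\<close>

lemma unturn_coshear_turn:
  assumes "N > 0" "odd N"
  shows "induced N (unturn N) \<circ> induced N (coshear k) \<circ> induced N turn = induced N (shear (2 * k))"
proof -
  have "reduce N ((unturn N \<circ> coshear k \<circ> turn) x) = reduce N (shear (2 * k) x)" for x
    using two_half[OF assms(2)] by (cases x) (simp add: mult.assoc mult.left_commute[of k 2])
  then have "induced N (unturn N \<circ> coshear k \<circ> turn) = induced N (shear (2 * k))"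
    by (rule induced_cong)
  then show ?thesis
    using assms by (simp add: induced_comp periodic_unturn periodic_coshear periodic_comp)
qed

text \<open>
  A single odd modulus above \<open>\<bar>a - b\<bar>\<close> suffices.
\<close>

lemma eq_if_cong_mod_all_odd:
  fixes a b :: int
  assumes "\<And>N. N > 0 \<Longrightarrow> odd N \<Longrightarrow> a mod N = b mod N"
  shows "a = b"
proof (rule ccontr)
  assume "a \<noteq> b"
  let ?N = "2 * \<bar>a - b\<bar> + 1"
  have "?N dvd a - b" using assms[of ?N] by (auto simp: mod_eq_dvd_iff)
  then have "?N \<le> \<bar>a - b\<bar>" using \<open>a \<noteq> b\<close> zdvd_imp_le[of ?N "\<bar>a - b\<bar>"] by simp
  then show False by simp
qed

lemma eq_if_reductions_eq:
  assumes "\<And>N. N > 0 \<Longrightarrow> odd N \<Longrightarrow> reduce N x = reduce N y"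
  shows "x = y"
  using assms by (cases x; cases y) (auto intro: eq_if_cong_mod_all_odd)

text \<open>
  On positive vectors, a shear applied last makes \<open>u\<close> the larger coordinate and a coshear applied last
  makes \<open>v\<close> the larger one.  The two words differ in their first letter, which acts last.
\<close>

lemma thue_morse_shears_ordered:
  assumes "k > 0" "p > 0" "q > 0" "u > 0" "v > 0"
  shows "(\<exists>u' v'. thue_morse (\<circ>) n (shear k) (coshear k) (p, q, u, v) = (p, q, u', v') \<and> u' > v' \<and> v' > 0) \<and>
    (\<exists>u' v'. thue_morse (\<circ>) n (coshear k) (shear k) (p, q, u, v) = (p, q, u', v') \<and> v' > u' \<and> u' > 0)"
  using assms(4,5)
proof (induction n arbitrary: u v)
  case 0
  have "k * p > 0" "k * q > 0" using assms by simp_all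
  then have "k * p * v \<ge> 1 * v" "k * q * u \<ge> 1 * u"
    using 0 by (intro mult_right_mono; simp)+
  then have "u + k * p * v > v" "v + k * q * u > u" using 0 by linarith+
  then show ?case using 0 by simp
next
  case (Suc n)
  from Suc.IH[OF Suc.prems] obtain u1 v1 where 1:
    "thue_morse (\<circ>) n (shear k) (coshear k) (p, q, u, v) = (p, q, u1, v1)" "u1 > v1" "v1 > 0"
    by (elim conjE exE)
  from Suc.IH[OF Suc.prems] obtain u2 v2 where 2:
    "thue_morse (\<circ>) n (coshear k) (shear k) (p, q, u, v) = (p, q, u2, v2)" "v2 > u2" "u2 > 0"
    by (elim conjE exE)
  have "u1 > 0" "v2 > 0" using 1 2 by simp_all
  moreover have "thue_morse (\<circ>) (Suc n) f g x = thue_morse (\<circ>) n f g (thue_morse (\<circ>) n g f x)"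
    for f g :: "point \<Rightarrow> point" and x by simp
  ultimately show ?case
    using Suc.IH[of u1 v1] Suc.IH[of u2 v2] 1 2 by (simp only: conj_absorb)
qed

section \<open>Alternating words and ping-pong\<close>

text \<open>
  The pair \<open>(False, k)\<close> stands for \<open>a\<^sup>k\<close> and \<open>(True, k)\<close> for \<open>b\<^sup>k\<close>.
\<close>

type_synonym syllable = "bool \<times> int"

text \<open>
  Conjugation by \<open>t\<close>.
\<close>

fun shift :: "syllable \<Rightarrow> syllable" where
  "shift (False, k) = (True, k)"
| "shift (True, k) = (False, 2 * k)"

fun syllable_act :: "syllable \<Rightarrow> point \<Rightarrow> point" where
  "syllable_act (False, k) = shear k"
| "syllable_act (True, k) = coshear k"

definition word_act :: "syllable list \<Rightarrow> point \<Rightarrow> point" where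
  "word_act w = foldr (\<lambda>s f. syllable_act s \<circ> f) w id"

lemma word_act_simps [simp]:
  "word_act [] = id" "word_act (s # w) = syllable_act s \<circ> word_act w"
  by (simp_all add: word_act_def)

fun reduced :: "syllable list \<Rightarrow> bool" where
  "reduced [] = True"
| "reduced [s] = (snd s \<noteq> 0)"
| "reduced (s # s' # w) = (snd s \<noteq> 0 \<and> fst s \<noteq> fst s' \<and> reduced (s' # w))"

text \<open>
  Multiplication by a syllable on the left, followed by the amalgamation that restores reducedness.
\<close>

fun push :: "syllable \<Rightarrow> syllable list \<Rightarrow> syllable list" where
  "push s [] = (if snd s = 0 then [] else [s])"
| "push s (s' # w) =
    (if snd s = 0 then s' # w
     else if fst s \<noteq> fst s' then s # s' # w
     else if snd s + snd s' = 0 then w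
     else (fst s, snd s + snd s') # w)"

lemma reduced_tl: "reduced (s # w) \<Longrightarrow> reduced w"
  by (cases w) auto

lemma reduced_push: "reduced w \<Longrightarrow> reduced (push s w)"
  by (cases "(s, w)" rule: push.cases; cases "tl w") (auto dest: reduced_tl)

lemma reduced_shift: "reduced w \<Longrightarrow> reduced (map shift w)"
proof (induction w rule: reduced.induct)
  case (2 s) then show ?case by (cases s rule: shift.cases) auto
next
  case (3 s s' w) then show ?case by (cases s rule: shift.cases; cases s' rule: shift.cases) auto
qed simp

fun dominated :: "bool \<Rightarrow> int \<Rightarrow> int \<Rightarrow> bool" where
  "dominated False u v \<longleftrightarrow> \<bar>v\<bar> < \<bar>u\<bar>"
| "dominated True u v \<longleftrightarrow> \<bar>u\<bar> < \<bar>v\<bar>"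

lemma ping_pong_step:
  fixes u v k :: int
  assumes "k \<noteq> 0" "\<bar>u\<bar> < \<bar>v\<bar>"
  shows "\<bar>v\<bar> < \<bar>u + k * 2 * v\<bar>"
proof -
  have "1 * \<bar>v\<bar> \<le> \<bar>k\<bar> * \<bar>v\<bar>" using assms(1) by (intro mult_right_mono) auto
  then have "2 * \<bar>v\<bar> \<le> \<bar>k * 2 * v\<bar>" by (simp add: abs_mult)
  then show ?thesis using assms(2) by linarith
qed

text \<open>
  Every syllable takes the region where its moving coordinate is the smaller one into the region where
  it is the larger one, and increases the maximum norm.  The hypothesis places the starting vector in
  the region required by the last syllable, which acts first.
\<close>

lemma ping_pong:
  assumes "reduced w" "w \<noteq> []" "dominated (\<not> fst (last w)) u v"
  shows "\<exists>u' v'. word_act w (2, 2, u, v) = (2, 2, u', v') \<and> dominated (fst (hd w)) u' v'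
    \<and> max \<bar>u\<bar> \<bar>v\<bar> < max \<bar>u'\<bar> \<bar>v'\<bar>"
  using assms
proof (induction w)
  case (Cons s w)
  obtain e k where s: "s = (e, k)" by (cases s)
  have k: "k \<noteq> 0" using Cons.prems(1) s by (cases w) auto
  have step: "\<exists>u' v'. syllable_act s (2, 2, u, v) = (2, 2, u', v') \<and> dominated e u' v'
    \<and> max \<bar>u\<bar> \<bar>v\<bar> < max \<bar>u'\<bar> \<bar>v'\<bar>" if "dominated (\<not> e) u v" for u v
    using that ping_pong_step[OF k, of u v] ping_pong_step[OF k, of v u] s by (cases e) auto
  show ?case
  proof (cases w)
    case Nil
    then show ?thesis using step[of u v] Cons.prems(3) s by simp
  next
    case (Cons s' w')
    then obtain u1 v1 where w: "word_act w (2, 2, u, v) = (2, 2, u1, v1)" "dominated (fst s') u1 v1"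
      "max \<bar>u\<bar> \<bar>v\<bar> < max \<bar>u1\<bar> \<bar>v1\<bar>"
      using Cons.IH Cons.prems reduced_tl by fastforce
    have "fst s' = (\<not> e)" using Cons.prems(1) Cons s by auto
    then obtain u2 v2 where "syllable_act s (2, 2, u1, v1) = (2, 2, u2, v2)" "dominated e u2 v2"
      "max \<bar>u1\<bar> \<bar>v1\<bar> < max \<bar>u2\<bar> \<bar>v2\<bar>"
      using step[of u1 v1] w(2) by auto
    then show ?thesis using w(1,3) s by (auto intro: less_trans)
  qed
qed simp

lemma reduced_word_act_nontrivial:
  assumes "reduced w" "w \<noteq> []"
  shows "\<exists>u v. word_act w (2, 2, u, v) \<noteq> (2, 2, u, v)"
proof -
  have "\<exists>u v. dominated (\<not> fst (last w)) u v"
  proof (cases "fst (last w)")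
    case True
    then show ?thesis by (intro exI[of _ 1] exI[of _ 0]) simp
  next
    case False
    then show ?thesis by (intro exI[of _ 0] exI[of _ 1]) simp
  qed
  then obtain u v where d: "dominated (\<not> fst (last w)) u v" by blast
  have "word_act w (2, 2, u, v) \<noteq> (2, 2, u, v)" using ping_pong[OF assms d] by auto
  then show ?thesis by blast
qed

lemma word_act_parameters: "\<exists>u' v'. word_act w (p, q, u, v) = (p, q, u', v')"
proof (induction w)
  case (Cons s w)
  then show ?case by (cases s rule: syllable_act.cases) auto
qed simp

fun parameter_product :: "point \<Rightarrow> int" where
  "parameter_product (p, q, u, v) = p * q"

lemma parameter_product_turn: "parameter_product ((turn ^^ n) x) = 2 ^ n * parameter_product x"
proof (induction n)
  case (Suc n)
  have "parameter_product (turn y) = 2 * parameter_product y" for y by (cases y) simp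
  then show ?case using Suc by simp
qed simp

lemma inj_turn: "inj turn"
  by (rule injI) (auto elim!: turn.elims)

text \<open>
  The product of the parameters counts the turns, so \<open>n = m\<close>; injectivity of \<open>turn\<close> leaves a reduced word
  that acts trivially.
\<close>

lemma turn_word_act_eq:
  assumes "reduced w" "\<And>x. (turn ^^ n) (word_act w x) = (turn ^^ m) x"
  shows "w = [] \<and> n = m"
proof -
  obtain u v where "word_act w (2, 2, 0, 0) = (2, 2, u, v)"
    using word_act_parameters by blast
  then have "2 ^ n * 4 = (2 ^ m * 4 :: int)"
    using arg_cong[OF assms(2)[of "(2, 2, 0, 0)"], of parameter_product]
    by (simp add: parameter_product_turn)
  then have "n = m" by simp
  moreover have "word_act w x = x" for x
    using assms(2)[of x] inj_fn[OF inj_turn, of n] \<open>n = m\<close> by (auto dest: injD)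
  ultimately show ?thesis using reduced_word_act_nontrivial[OF assms(1)] by blast
qed


section \<open>Normal forms in groups with the doubling relation\<close>

locale doubling_group = group G for G (structure) +
  fixes A T
  assumes A_closed [simp]: "A \<in> carrier G" and T_closed [simp]: "T \<in> carrier G"
    and doubling: "T \<otimes> T \<otimes> A \<otimes> inv T \<otimes> inv T = A \<otimes> A"
begin

definition B where "B = T \<otimes> A \<otimes> inv T"

lemma B_closed [simp]: "B \<in> carrier G"
  by (simp add: B_def)

lemma T_A: "T \<otimes> A = B \<otimes> T"
  by (simp add: B_def m_assoc)

lemma T_B: "T \<otimes> B = A \<otimes> A \<otimes> T"
proof -
  have "A \<otimes> A \<otimes> T = T \<otimes> T \<otimes> A \<otimes> inv T \<otimes> inv T \<otimes> T" by (simp add: doubling)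
  then show ?thesis by (simp add: B_def m_assoc)
qed

lemma intertwine_int_pow:
  assumes "x \<in> carrier G" "y \<in> carrier G" "g \<in> carrier G" "g \<otimes> x = y \<otimes> g"
  shows "g \<otimes> x [^] (k::int) = y [^] k \<otimes> g"
proof -
  have y: "y = g \<otimes> x \<otimes> inv g" using assms by (simp add: m_assoc)
  have nat: "g \<otimes> x [^] (n::nat) = y [^] n \<otimes> g" for n
  proof (induction n)
    case (Suc n)
    have "g \<otimes> x [^] Suc n = (g \<otimes> x [^] n) \<otimes> x" using assms by (simp add: m_assoc)
    also have "\<dots> = y [^] n \<otimes> (g \<otimes> x)" using assms Suc by (simp add: m_assoc)
    also have "\<dots> = y [^] Suc n \<otimes> g" using assms by (simp add: m_assoc)
    finally show ?case .
  qed (use assms in simp)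
  have neg: "g \<otimes> inv (x [^] n) = inv (y [^] n) \<otimes> g" for n :: nat
  proof -
    have "inv (y [^] n) \<otimes> (y [^] n \<otimes> g) \<otimes> inv (x [^] n) = inv (y [^] n) \<otimes> (g \<otimes> x [^] n) \<otimes> inv (x [^] n)"
      by (simp add: nat)
    moreover have "inv (y [^] n) \<otimes> (y [^] n \<otimes> g) = g"
      using assms by (simp add: m_assoc[symmetric])
    moreover have "inv (y [^] n) \<otimes> (g \<otimes> x [^] n) \<otimes> inv (x [^] n) = inv (y [^] n) \<otimes> g"
      using assms by (simp add: m_assoc)
    ultimately show ?thesis by simp
  qed
  show ?thesis by (cases k rule: int_cases2) (simp_all add: int_pow_int nat int_pow_neg_int neg assms)
qed

fun syllable_val :: "syllable \<Rightarrow> 'a" where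
  "syllable_val (False, k) = A [^] k"
| "syllable_val (True, k) = B [^] k"

definition word_val :: "syllable list \<Rightarrow> 'a" where
  "word_val w = foldr (\<lambda>s g. syllable_val s \<otimes> g) w \<one>"

lemma word_val_simps [simp]:
  "word_val [] = \<one>" "word_val (s # w) = syllable_val s \<otimes> word_val w"
  by (simp_all add: word_val_def)

lemma syllable_val_closed [simp]: "syllable_val s \<in> carrier G"
  by (cases s rule: syllable_val.cases) auto

lemma word_val_closed [simp]: "word_val w \<in> carrier G"
  by (induction w) auto

lemma syllable_val_0: "snd s = 0 \<Longrightarrow> syllable_val s = \<one>"
  by (cases s rule: syllable_val.cases) auto

lemma syllable_val_add: "syllable_val (e, k) \<otimes> syllable_val (e, l) = syllable_val (e, k + l)"
  by (cases e) (simp_all add: int_pow_mult)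

lemma word_val_push: "word_val (push s w) = syllable_val s \<otimes> word_val w"
proof (cases w)
  case Nil
  then show ?thesis by (simp add: syllable_val_0)
next
  case (Cons s' w')
  have "syllable_val s \<otimes> (syllable_val s' \<otimes> word_val w')
      = syllable_val (fst s, snd s + snd s') \<otimes> word_val w'" if "fst s = fst s'"
    using that syllable_val_add[of "fst s" "snd s" "snd s'"] by (cases s; cases s') (simp flip: m_assoc)
  moreover have "syllable_val (fst s, snd s + snd s') = \<one>" if "snd s + snd s' = 0"
    using that by (simp add: syllable_val_0)
  ultimately show ?thesis using Cons by (auto simp: syllable_val_0)
qed

lemma T_syllable_val: "T \<otimes> syllable_val s = syllable_val (shift s) \<otimes> T"
proof (cases s rule: shift.cases)
  case (1 k)
  then show ?thesis by (simp add: intertwine_int_pow T_A)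
next
  case (2 k)
  have "(A \<otimes> A) [^] k = A [^] (2 * k)"
    using int_pow_pow[of A 2 k] by (simp add: int_pow_mult[of A 1 1, simplified])
  then show ?thesis using 2 by (simp add: intertwine_int_pow[OF _ _ _ T_B])
qed

lemma T_word_val: "T \<otimes> word_val w = word_val (map shift w) \<otimes> T"
proof (induction w)
  case (Cons s w)
  have "T \<otimes> word_val (s # w) = syllable_val (shift s) \<otimes> (T \<otimes> word_val w)"
    by (simp add: T_syllable_val flip: m_assoc)
  then show ?case by (simp add: Cons m_assoc)
qed simp

text \<open>
  Conjugation by \<open>T\<close> maps powers of \<open>A\<close> and of \<open>B\<close> to such powers, so \<open>T\<inverse>\<close> can be moved to the left of
  a syllable.
\<close>

lemma syllable_val_inv_T_pow:
  "\<exists>s'. syllable_val s \<otimes> inv T [^] (n::nat) = inv T [^] n \<otimes> syllable_val s'"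
proof (induction n)
  case 0
  show ?case by (intro exI[of _ s]) simp
next
  case (Suc n)
  then obtain s' where s': "syllable_val s \<otimes> inv T [^] n = inv T [^] n \<otimes> syllable_val s'" by blast
  have swap: "syllable_val s' \<otimes> inv T = inv T \<otimes> syllable_val (shift s')"
  proof -
    have "inv T \<otimes> syllable_val (shift s') = inv T \<otimes> (syllable_val (shift s') \<otimes> T) \<otimes> inv T"
      by (simp add: m_assoc)
    also have "\<dots> = inv T \<otimes> (T \<otimes> syllable_val s') \<otimes> inv T" by (simp add: T_syllable_val)
    also have "\<dots> = syllable_val s' \<otimes> inv T" by (simp flip: m_assoc)
    finally show ?thesis by simp
  qed
  have "syllable_val s \<otimes> inv T [^] Suc n = syllable_val s \<otimes> inv T [^] n \<otimes> inv T"
    by (simp add: m_assoc)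
  also have "\<dots> = inv T [^] n \<otimes> (syllable_val s' \<otimes> inv T)" by (simp add: s' m_assoc)
  also have "\<dots> = inv T [^] Suc n \<otimes> syllable_val (shift s')" by (simp add: swap flip: m_assoc)
  finally show ?case by blast
qed

text \<open>
  The exponents \<open>n\<close> and \<open>m\<close> can be increased together, so an element has many normal forms.
\<close>

definition normal_form :: "'a \<Rightarrow> bool" where
  "normal_form g \<longleftrightarrow> (\<exists>(n::nat) w (m::nat). reduced w \<and> g = inv T [^] n \<otimes> word_val w \<otimes> T [^] m)"

lemma normal_form_one: "normal_form \<one>"
  unfolding normal_form_def by (intro exI[of _ 0] exI[of _ "[]"]) simp

lemma normal_form_inv_T: "normal_form g \<Longrightarrow> normal_form (inv T \<otimes> g)"
proof -
  assume "normal_form g"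
  then obtain n w m where "reduced w" "g = inv T [^] (n::nat) \<otimes> word_val w \<otimes> T [^] (m::nat)"
    by (auto simp: normal_form_def)
  then have "inv T \<otimes> g = inv T [^] Suc n \<otimes> word_val w \<otimes> T [^] m"
    by (subst nat_pow_Suc2) (simp_all add: m_assoc)
  then show ?thesis unfolding normal_form_def using \<open>reduced w\<close> by blast
qed

lemma normal_form_T: "normal_form g \<Longrightarrow> normal_form (T \<otimes> g)"
proof -
  assume "normal_form g"
  then obtain n w m where g: "reduced w" "g = inv T [^] (n::nat) \<otimes> word_val w \<otimes> T [^] (m::nat)"
    by (auto simp: normal_form_def)
  show ?thesis
  proof (cases n)
    case 0
    have "T \<otimes> g = T \<otimes> word_val w \<otimes> T [^] m" by (simp add: g(2) 0 m_assoc)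
    also have "\<dots> = word_val (map shift w) \<otimes> (T \<otimes> T [^] m)" by (simp add: T_word_val m_assoc)
    also have "\<dots> = inv T [^] (0::nat) \<otimes> word_val (map shift w) \<otimes> T [^] Suc m"
      by (subst nat_pow_Suc2) (simp_all add: m_assoc)
    finally show ?thesis unfolding normal_form_def using reduced_shift[OF g(1)] by blast
  next
    case (Suc n')
    then have "inv T [^] n = inv T \<otimes> inv T [^] n'" by (simp only: nat_pow_Suc2 inv_closed T_closed)
    then have "T \<otimes> g = inv T [^] n' \<otimes> word_val w \<otimes> T [^] m"
      by (simp add: g(2) m_assoc[symmetric] del: nat_pow_Suc)
    then show ?thesis unfolding normal_form_def using g(1) by blast
  qed
qed

lemma normal_form_syllable: "normal_form g \<Longrightarrow> normal_form (syllable_val s \<otimes> g)"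
proof -
  assume "normal_form g"
  then obtain n w m where g: "reduced w" "g = inv T [^] (n::nat) \<otimes> word_val w \<otimes> T [^] (m::nat)"
    by (auto simp: normal_form_def)
  obtain s' where s': "syllable_val s \<otimes> inv T [^] n = inv T [^] n \<otimes> syllable_val s'"
    using syllable_val_inv_T_pow by blast
  have "syllable_val s \<otimes> g = syllable_val s \<otimes> inv T [^] n \<otimes> word_val w \<otimes> T [^] m"
    by (simp add: g(2) m_assoc)
  also have "\<dots> = inv T [^] n \<otimes> word_val (push s' w) \<otimes> T [^] m"
    by (simp add: s' m_assoc word_val_push)
  finally show ?thesis unfolding normal_form_def using reduced_push[OF g(1)] by blast
qed

end

section \<open>Detecting elements in finite quotients\<close>

text \<open>
  The family \<open>\<phi>\<close> consists of the actions modulo all odd \<open>N\<close>.  They are treated together because only the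
  whole family sees the integral maps of which they are reductions.
\<close>

locale doubling_action = doubling_group +
  fixes \<phi> :: "int \<Rightarrow> 'a \<Rightarrow> point \<Rightarrow> point"
  assumes \<phi>_hom: "N > 0 \<Longrightarrow> odd N \<Longrightarrow> \<phi> N \<in> hom G (perm_group (residue_box N))"
    and \<phi>_A: "N > 0 \<Longrightarrow> odd N \<Longrightarrow> \<phi> N A = induced N (shear 1)"
    and \<phi>_T: "N > 0 \<Longrightarrow> odd N \<Longrightarrow> \<phi> N T = induced N (unturn N)"
begin

text \<open>
  The element \<open>g\<close> acts modulo every odd \<open>N\<close> through the same map on integers.  This holds for \<open>A\<close>, \<open>B\<close> and
  \<open>inv T\<close>, but not for \<open>T\<close>, which halves a coordinate.
\<close>

definition acts_as :: "'a \<Rightarrow> (point \<Rightarrow> point) \<Rightarrow> bool" where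
  "acts_as g f \<longleftrightarrow> g \<in> carrier G \<and> (\<forall>N>0. odd N \<longrightarrow> periodic N f \<and> \<phi> N g = induced N f)"

lemma \<phi>_mult: "N > 0 \<Longrightarrow> odd N \<Longrightarrow> g \<in> carrier G \<Longrightarrow> h \<in> carrier G \<Longrightarrow> \<phi> N (g \<otimes> h) = \<phi> N g \<circ> \<phi> N h"
  using hom_mult[OF \<phi>_hom] by simp

lemma \<phi>_one: "N > 0 \<Longrightarrow> odd N \<Longrightarrow> \<phi> N \<one> = id"
  using hom_one[OF \<phi>_hom is_group group_perm_group] by simp

lemma \<phi>_inv:
  assumes "N > 0" "odd N" "g \<in> carrier G" "p \<circ> \<phi> N g = id"
  shows "\<phi> N (inv g) = p"
proof -
  have "\<phi> N g \<circ> \<phi> N (inv g) = id" using \<phi>_mult[of N g "inv g"] assms by (simp add: \<phi>_one)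
  then have "p \<circ> \<phi> N g \<circ> \<phi> N (inv g) = p" by (simp add: comp_assoc)
  then show ?thesis using assms(4) by simp
qed

lemma acts_as_one: "acts_as \<one> id"
  by (simp add: acts_as_def periodic_id \<phi>_one induced_id)

lemma acts_as_mult: "acts_as g f \<Longrightarrow> acts_as h f' \<Longrightarrow> acts_as (g \<otimes> h) (f \<circ> f')"
  by (simp add: acts_as_def periodic_comp \<phi>_mult induced_comp)

lemma acts_as_inv:
  assumes "acts_as g f" "f' \<circ> f = id" "\<And>N. periodic N f'"
  shows "acts_as (inv g) f'"
  unfolding acts_as_def
proof (intro conjI allI impI)
  fix N :: int assume N: "N > 0" "odd N"
  have "induced N f' \<circ> \<phi> N g = id"
    using assms N by (simp add: acts_as_def induced_comp induced_id)
  then show "\<phi> N (inv g) = induced N f'"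
    using assms(1) N by (intro \<phi>_inv) (auto simp: acts_as_def)
qed (use assms in \<open>auto simp: acts_as_def\<close>)

lemma acts_as_pow: "acts_as g f \<Longrightarrow> acts_as (g [^] (n::nat)) (f ^^ n)"
proof (induction n)
  case (Suc n)
  then show ?case using acts_as_mult[of "g [^] n" "f ^^ n" g f] by (simp add: funpow_swap1 comp_def)
qed (simp add: acts_as_one)

lemma acts_as_int_pow:
  assumes "acts_as g (f 1)" "\<And>k l. f k \<circ> f l = f (k + l)" "f 0 = id" "\<And>N k. periodic N (f k)"
  shows "acts_as (g [^] (k::int)) (f k)"
proof -
  have pow: "f 1 ^^ n = f (int n)" for n
    by (induction n) (simp_all add: assms(2,3))
  have nat: "acts_as (g [^] n) (f (int n))" for n :: nat
    using acts_as_pow[OF assms(1), of n] by (simp add: pow)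
  have g: "g \<in> carrier G" using assms(1) by (simp add: acts_as_def)
  show ?thesis
  proof (cases k rule: int_cases2)
    case (nonneg n)
    then show ?thesis using nat[of n] by (simp add: int_pow_int)
  next
    case (nonpos n)
    have "acts_as (inv (g [^] n)) (f (- int n))"
      by (rule acts_as_inv[OF nat]) (simp_all add: assms(2-4))
    then show ?thesis using nonpos g by (simp add: int_pow_neg_int)
  qed
qed

lemma acts_as_A: "acts_as A (shear 1)"
  by (simp add: acts_as_def periodic_shear \<phi>_A)

lemma acts_as_inv_T: "acts_as (inv T) turn"
  by (auto simp: acts_as_def periodic_turn \<phi>_T turn_unturn intro!: \<phi>_inv)

lemma acts_as_B: "acts_as B (coshear 1)"
proof -
  have "\<phi> N B = induced N (coshear 1)" if "N > 0" "odd N" for N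
    using that acts_as_inv_T by (simp add: B_def \<phi>_mult \<phi>_A \<phi>_T acts_as_def unturn_shear_turn)
  then show ?thesis by (simp add: acts_as_def periodic_coshear)
qed

lemma acts_as_syllable: "acts_as (syllable_val s) (syllable_act s)"
  by (cases s rule: syllable_act.cases)
    (simp_all add: acts_as_int_pow acts_as_A acts_as_B shear_add coshear_add shear_0 coshear_0
      periodic_shear periodic_coshear)

lemma acts_as_word: "acts_as (word_val w) (word_act w)"
  by (induction w) (simp_all only: word_val_simps word_act_simps acts_as_one acts_as_mult acts_as_syllable)

lemma acts_as_unique:
  assumes "acts_as g f" "acts_as h f'" "\<And>N. N > 0 \<Longrightarrow> odd N \<Longrightarrow> \<phi> N g = \<phi> N h"
  shows "f x = f' x"
proof (rule eq_if_reductions_eq)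
  fix N :: int assume N: "N > 0" "odd N"
  have f: "periodic N f" "\<phi> N g = induced N f" and f': "periodic N f'" "\<phi> N h = induced N f'"
    using assms(1,2) N by (simp_all add: acts_as_def)
  have "induced N f (reduce N x) = induced N f' (reduce N x)"
    using assms(3)[OF N] f(2) f'(2) by simp
  then show "reduce N (f x) = reduce N (f' x)"
    by (simp add: induced_reduce N f(1) f'(1))
qed

text \<open>
  If \<open>g = T\<^sup>-\<^sup>n w T\<^sup>m\<close> acts trivially everywhere, then \<open>T\<^sup>-\<^sup>n w\<close> and \<open>T\<^sup>-\<^sup>m\<close> act alike.  Both act through
  integral maps, which must then coincide.
\<close>

lemma normal_form_separated:
  assumes g: "g \<in> carrier G" "normal_form g" "g \<noteq> \<one>"
  shows "\<exists>N>0. odd N \<and> \<phi> N g \<noteq> id"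
proof (rule ccontr)
  assume "\<not> ?thesis"
  then have triv: "\<phi> N g = id" if "N > 0" "odd N" for N using that by blast
  obtain n w m where w: "reduced w" and nf: "g = inv T [^] (n::nat) \<otimes> word_val w \<otimes> T [^] (m::nat)"
    using g(2) by (auto simp: normal_form_def)
  have eq: "inv T [^] n \<otimes> word_val w = g \<otimes> inv T [^] m"
    by (simp add: nf m_assoc nat_pow_inv)
  have left: "acts_as (inv T [^] n \<otimes> word_val w) (turn ^^ n \<circ> word_act w)"
    by (intro acts_as_mult acts_as_pow acts_as_inv_T acts_as_word)
  have right: "acts_as (inv T [^] m) (turn ^^ m)"
    by (intro acts_as_pow acts_as_inv_T)
  have "(turn ^^ n \<circ> word_act w) x = (turn ^^ m) x" for x
    by (rule acts_as_unique[OF left right]) (simp add: eq \<phi>_mult g(1) triv)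
  then have "w = [] \<and> n = m" by (intro turn_word_act_eq[OF w]) simp
  then have "g = \<one>" by (simp add: nf nat_pow_inv)
  then show False using g(3) by simp
qed

lemma thue_morse_words_distinct:
  assumes "k > 0"
  shows "thue_morse (\<otimes>) n (A [^] (k::nat)) (B [^] k) \<noteq> thue_morse (\<otimes>) n (B [^] k) (A [^] k)"
proof
  assume eq: "thue_morse (\<otimes>) n (A [^] k) (B [^] k) = thue_morse (\<otimes>) n (B [^] k) (A [^] k)"
  have A: "acts_as (A [^] k) (shear (int k))" and B: "acts_as (B [^] k) (coshear (int k))"
    using acts_as_syllable[of "(False, int k)"] acts_as_syllable[of "(True, int k)"]
    by (simp_all add: int_pow_int)
  have thue_morse: "acts_as (thue_morse (\<otimes>) n g h) (thue_morse (\<circ>) n f f')" if "acts_as g f" "acts_as h f'" for g h f f'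
    using that by (induction n arbitrary: g h f f') (simp_all add: acts_as_mult)
  have "thue_morse (\<circ>) n (shear (int k)) (coshear (int k)) x = thue_morse (\<circ>) n (coshear (int k)) (shear (int k)) x" for x
    by (rule acts_as_unique[OF thue_morse[OF A B] thue_morse[OF B A]]) (simp add: eq)
  then show False
    using thue_morse_shears_ordered[of "int k" 1 1 1 1 n] assms by force
qed

end


section \<open>Matrices as endomorphisms of a fixed vector space\<close>

text \<open>
  Algebraicity is the only trace of finite dimension that the argument needs.
\<close>

lemma (in doubling_action) no_faithful_algebraic_representation:
  fixes c :: "'k::field \<Rightarrow> 'r::ring_1"
  assumes c: "unital_algebra c"
    and mult: "\<And>g h. g \<in> carrier G \<Longrightarrow> h \<in> carrier G \<Longrightarrow> \<rho> (g \<otimes> h) = \<rho> g * \<rho> h"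
    and one: "\<rho> \<one> = 1"
    and alg: "\<And>g. g \<in> carrier G \<Longrightarrow> unital_algebra.split_algebraic c (\<rho> g)"
  shows "\<not> inj_on \<rho> (carrier G)"
proof
  assume inj: "inj_on \<rho> (carrier G)"
  have unit: "two_sided_unit (\<rho> g)" if "g \<in> carrier G" for g
    using that by (intro two_sided_unitI[of _ "\<rho> (inv g)" "\<rho> (inv g)"]) (simp_all add: mult[symmetric] one)
  have pow: "\<rho> (g [^] (n::nat)) = \<rho> g ^ n" if "g \<in> carrier G" for g n
    using that by (induction n) (simp_all add: one mult power_commutes)
  have "\<rho> T * \<rho> A = \<rho> B * \<rho> T" by (simp add: mult[symmetric] T_A)
  moreover have "\<rho> T * \<rho> B = (\<rho> A)\<^sup>2 * \<rho> T"
    by (simp add: mult[symmetric] T_B power2_eq_square)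
  moreover have "unital_algebra.split_algebraic c (\<rho> T * \<rho> T)"
    using alg[of "T \<otimes> T"] by (simp add: mult)
  ultimately obtain N n where N: "N > 0"
    "thue_morse (*) n (\<rho> A ^ N) (\<rho> B ^ N) = thue_morse (*) n (\<rho> B ^ N) (\<rho> A ^ N)"
    using unital_algebra.thue_morse_collapse[OF c alg[OF A_closed] unit[OF A_closed] _ unit[OF T_closed]]
    by blast
  have thue_morse: "thue_morse (\<otimes>) n g h \<in> carrier G \<and> \<rho> (thue_morse (\<otimes>) n g h) = thue_morse (*) n (\<rho> g) (\<rho> h)"
    if "g \<in> carrier G" "h \<in> carrier G" for g h n
    using that by (induction n arbitrary: g h) (simp_all add: mult)
  have "\<rho> (thue_morse (\<otimes>) n (A [^] N) (B [^] N)) = \<rho> (thue_morse (\<otimes>) n (B [^] N) (A [^] N))"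
    using thue_morse N(2) by (simp add: pow)
  then have "thue_morse (\<otimes>) n (A [^] N) (B [^] N) = thue_morse (\<otimes>) n (B [^] N) (A [^] N)"
    using thue_morse by (intro inj_onD[OF inj]) simp_all
  then show False using thue_morse_words_distinct[OF N(1)] by blast
qed

text \<open>
  Linear endomorphisms of the space of all sequences.  Matrices of every size embed into this single
  type, which, in contrast to matrices whose size is a value, is a ring in the sense of type classes.
\<close>

typedef (overloaded) 'k endo = "{f :: (nat \<Rightarrow> 'k::field) \<Rightarrow> nat \<Rightarrow> 'k.
    (\<forall>x y. f (\<lambda>i. x i + y i) = (\<lambda>i. f x i + f y i)) \<and> (\<forall>k x. f (\<lambda>i. k * x i) = (\<lambda>i. k * f x i))}"
  by (rule exI[of _ "\<lambda>x. x"]) simp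

setup_lifting type_definition_endo

instantiation endo :: (field) ring_1
begin

lift_definition zero_endo :: "'a endo" is "\<lambda>x i. 0" by simp
lift_definition one_endo :: "'a endo" is "\<lambda>x. x" by simp
lift_definition plus_endo :: "'a endo \<Rightarrow> 'a endo \<Rightarrow> 'a endo" is "\<lambda>f g x i. f x i + g x i"
  by (simp add: algebra_simps)
lift_definition uminus_endo :: "'a endo \<Rightarrow> 'a endo" is "\<lambda>f x i. - f x i" by simp
lift_definition minus_endo :: "'a endo \<Rightarrow> 'a endo \<Rightarrow> 'a endo" is "\<lambda>f g x i. f x i - g x i"
  by (simp add: algebra_simps)
lift_definition times_endo :: "'a endo \<Rightarrow> 'a endo \<Rightarrow> 'a endo" is "\<lambda>f g x. f (g x)" by simp

instance
proof
  show "(0::'a endo) \<noteq> 1"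
    by transfer (metis zero_neq_one)
qed (transfer; simp add: algebra_simps fun_eq_iff)+

end

lift_definition scalar :: "'k::field \<Rightarrow> 'k endo" is "\<lambda>k x i. k * x i"
  by (simp add: algebra_simps)

lemma unital_algebra_scalar: "unital_algebra scalar"
  by (unfold_locales; transfer) (simp_all add: algebra_simps)

text \<open>
  The matrix acts on the first \<open>n\<close> coordinates and the identity on the others, so that the identity
  matrix becomes \<open>1\<close>.  The entries are moved to the algebraic closure.
\<close>

lift_definition mat_endo :: "nat \<Rightarrow> 'k::field mat \<Rightarrow> 'k alg_closure endo" is
  "\<lambda>n M x i. if i < n then \<Sum>j<n. to_ac (M $$ (i, j)) * x j else x i"
  by (auto simp: fun_eq_iff distrib_left sum.distrib sum_distrib_left mult.left_commute)

lift_definition matrix_unit :: "nat \<Rightarrow> nat \<Rightarrow> 'k::field endo" is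
  "\<lambda>i j x k. if k = i then x j else 0"
  by (auto simp: fun_eq_iff)

lift_definition tail_projection :: "nat \<Rightarrow> 'k::field endo" is
  "\<lambda>n x k. if k < n then 0 else x k"
  by (auto simp: fun_eq_iff)

lemma mat_endo_mult:
  assumes "M \<in> carrier_mat n n" "M' \<in> carrier_mat n n"
  shows "mat_endo n (M * M') = mat_endo n M * mat_endo n M'"
  using assms
proof transfer
  fix n and M M' :: "'a mat"
  assume M: "M \<in> carrier_mat n n" "M' \<in> carrier_mat n n"
  have entry: "(M * M') $$ (i, j) = (\<Sum>k<n. M $$ (i, k) * M' $$ (k, j))" if "i < n" "j < n" for i j
    using M that by (simp add: scalar_prod_def atLeast0LessThan)
  show "(\<lambda>x i. if i < n then \<Sum>j<n. to_ac ((M * M') $$ (i, j)) * x j else x i) =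
    (\<lambda>x i. if i < n then \<Sum>j<n. to_ac (M $$ (i, j)) *
        (if j < n then \<Sum>k<n. to_ac (M' $$ (j, k)) * x k else x j)
      else if i < n then \<Sum>j<n. to_ac (M' $$ (i, j)) * x j else x i)"
  proof (intro ext if_cong HOL.refl)
    fix x :: "nat \<Rightarrow> 'a alg_closure" and i assume i: "i < n"
    have "(\<Sum>j<n. to_ac ((M * M') $$ (i, j)) * x j)
        = (\<Sum>j<n. \<Sum>k<n. to_ac (M $$ (i, k)) * (to_ac (M' $$ (k, j)) * x j))"
      using i by (intro sum.cong) (simp_all add: entry to_ac_sum sum_distrib_right mult.assoc)
    also have "\<dots> = (\<Sum>k<n. \<Sum>j<n. to_ac (M $$ (i, k)) * (to_ac (M' $$ (k, j)) * x j))"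
      by (rule sum.swap)
    also have "\<dots> = (\<Sum>j<n. to_ac (M $$ (i, j)) *
        (if j < n then \<Sum>k<n. to_ac (M' $$ (j, k)) * x k else x j))"
      by (simp add: sum_distrib_left)
    finally show "(\<Sum>j<n. to_ac ((M * M') $$ (i, j)) * x j) = \<dots>" .
  qed simp
qed

lemma mat_endo_one: "mat_endo n (1\<^sub>m n) = 1"
proof transfer
  fix n
  have "(\<Sum>j<n. to_ac (1\<^sub>m n $$ (i, j)) * x j) = x i" if "i < n" for i and x :: "nat \<Rightarrow> 'a alg_closure"
  proof -
    have "(\<Sum>j<n. to_ac (1\<^sub>m n $$ (i, j)) * x j) = (\<Sum>j<n. if j = i then x i else 0)"
      using that by (intro sum.cong) auto
    then show ?thesis using that by simp
  qed
  then show "(\<lambda>x i. if i < n then \<Sum>j<n. to_ac (1\<^sub>m n $$ (i, j)) * x j else x i) = (\<lambda>x::nat \<Rightarrow> 'a alg_closure. x)"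
    by (intro ext) simp
qed

lemma mat_endo_inject:
  assumes "M \<in> carrier_mat n n" "M' \<in> carrier_mat n n" "mat_endo n M = mat_endo n M'"
  shows "M = M'"
proof (rule eq_matI)
  fix i j assume "i < dim_row M'" "j < dim_col M'"
  then have ij: "i < n" "j < n" using assms(2) by auto
  have col: "Rep_endo (mat_endo n M) (\<lambda>k. if k = j then 1 else 0) i = to_ac (M $$ (i, j))" for M :: "'a mat"
    using ij by (simp add: mat_endo.rep_eq if_distrib cong: if_cong)
  show "M $$ (i, j) = M' $$ (i, j)"
    using col[of M] col[of M'] assms(3) by simp
qed (use assms in auto)

lemma Rep_endo_sum: "Rep_endo (sum f S) x i = (\<Sum>s\<in>S. Rep_endo (f s) x i)"
  by (induction S rule: infinite_finite_induct) (simp_all add: zero_endo.rep_eq plus_endo.rep_eq)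

lemma mat_endo_eq_sum:
  "mat_endo n M = tail_projection n + (\<Sum>i<n. \<Sum>j<n. scalar (to_ac (M $$ (i, j))) * matrix_unit i j)"
proof -
  have "Rep_endo (mat_endo n M) x k = Rep_endo (tail_projection n +
      (\<Sum>i<n. \<Sum>j<n. scalar (to_ac (M $$ (i, j))) * matrix_unit i j)) x k" for x k
  proof -
    have "(\<Sum>i<n. \<Sum>j<n. Rep_endo (scalar (to_ac (M $$ (i, j))) * matrix_unit i j) x k)
        = (\<Sum>i<n. if i = k then \<Sum>j<n. to_ac (M $$ (k, j)) * x j else 0)"
      by (intro sum.cong) (auto simp: times_endo.rep_eq scalar.rep_eq matrix_unit.rep_eq)
    then show ?thesis
      by (simp add: mat_endo.rep_eq plus_endo.rep_eq tail_projection.rep_eq Rep_endo_sum)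
  qed
  then show ?thesis by (simp add: Rep_endo_inject[symmetric] fun_eq_iff)
qed

text \<open>
  All images of matrices of size \<open>n\<close> lie in the span of the matrix units and one projection.
\<close>

lemma mat_endo_split_algebraic:
  fixes M :: "'k::field mat"
  assumes M: "M \<in> carrier_mat n n"
  shows "unital_algebra.split_algebraic scalar (mat_endo n M)"
proof -
  interpret unital_algebra "scalar :: 'k alg_closure \<Rightarrow> _" by (rule unital_algebra_scalar)
  interpret vs: vector_space "\<lambda>k x. scalar k * x :: 'k alg_closure endo" by (rule vector_space)
  define S :: "'k alg_closure endo set" where "S = insert (tail_projection n) ((\<lambda>(i, j). matrix_unit i j) ` ({..<n} \<times> {..<n}))"
  have "finite S" by (simp add: S_def)
  moreover have span: "mat_endo n M' \<in> vs.span S" for M' :: "'k mat"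
    unfolding mat_endo_eq_sum
    by (intro vs.span_add vs.span_sum vs.span_scale vs.span_base) (auto simp: S_def)
  moreover have "mat_endo n M ^ k = mat_endo n (M ^\<^sub>m k)" for k
  proof (induction k)
    case 0
    then show ?case using M by (simp add: mat_endo_one)
  next
    case (Suc k)
    have "mat_endo n M ^ Suc k = mat_endo n M ^ k * mat_endo n M" by (simp add: power_commutes)
    then show ?case using Suc mat_endo_mult[OF pow_carrier_mat[OF M] M] by simp
  qed
  ultimately show ?thesis
    by (intro split_algebraic_if_powers_in_finite_span[OF unital_algebra_scalar]) auto
qed

lemma (in doubling_action) not_linear: "\<not> linear_over TYPE('k::field) G"
proof
  assume "linear_over TYPE('k) G"
  then obtain n H \<psi> where H: "subgroup H (general_linear_group TYPE('k) n)"
    and \<psi>: "\<psi> \<in> iso G ((general_linear_group TYPE('k) n)\<lparr>carrier := H\<rparr>)"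
    by (auto simp: linear_over_def is_iso_def)
  let ?GL = "general_linear_group TYPE('k) n"
  have GL: "carrier ?GL \<subseteq> carrier_mat n n" "\<one>\<^bsub>?GL\<^esub> = 1\<^sub>m n"
    by (auto simp: general_linear_group_def units_of_def Units_def ring_mat_def)
  have GL_mult: "x \<otimes>\<^bsub>?GL\<^esub> y = x * y" for x y
    by (simp add: general_linear_group_def units_of_def ring_mat_def)
  have closed: "\<psi> g \<in> carrier_mat n n" if "g \<in> carrier G" for g
    using \<psi> that GL(1) subgroup.subset[OF H] by (auto simp: iso_def hom_def)
  have mult: "\<psi> (g \<otimes> h) = \<psi> g * \<psi> h" if "g \<in> carrier G" "h \<in> carrier G" for g h
    using \<psi> that by (auto simp: iso_def hom_def GL_mult)
  have one: "\<psi> \<one> = 1\<^sub>m n"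
  proof -
    have "group (?GL\<lparr>carrier := H\<rparr>)"
      by (rule subgroup.subgroup_is_group[OF H group_general_linear_group])
    then have "\<psi> \<one> = \<one>\<^bsub>?GL\<lparr>carrier := H\<rparr>\<^esub>"
      using \<psi> by (intro hom_one is_group) (auto simp: iso_def)
    then show ?thesis by (simp add: GL(2))
  qed
  have "inj_on (mat_endo n \<circ> \<psi>) (carrier G)"
  proof (rule inj_onI)
    fix g h assume gh: "g \<in> carrier G" "h \<in> carrier G" "(mat_endo n \<circ> \<psi>) g = (mat_endo n \<circ> \<psi>) h"
    then have "\<psi> g = \<psi> h" using mat_endo_inject[OF closed closed] by simp
    then show "g = h" using \<psi> gh by (auto simp: iso_def bij_betw_def dest: inj_onD)
  qed
  moreover have "\<not> inj_on (mat_endo n \<circ> \<psi>) (carrier G)"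
    by (rule no_faithful_algebraic_representation[OF unital_algebra_scalar])
      (simp_all add: mult mat_endo_mult closed one mat_endo_one mat_endo_split_algebraic)
  ultimately show False by blast
qed

lemma (in doubling_action) residually_finite:
  assumes nf: "\<And>g. g \<in> carrier G \<Longrightarrow> normal_form g"
  shows "residually_finite G"
proof (rule residually_finiteI)
  fix g assume g: "g \<in> carrier G" "g \<noteq> \<one>"
  then obtain N where N: "N > 0" "odd N" "\<phi> N g \<noteq> id"
    using normal_form_separated nf by blast
  then show "\<exists>(F :: (point \<Rightarrow> point) monoid) \<theta>. group F \<and> finite (carrier F) \<and> \<theta> \<in> hom G F \<and> \<theta> g \<noteq> \<one>\<^bsub>F\<^esub>"
    by (intro exI[of _ "perm_group (residue_box N)"] exI[of _ "\<phi> N"])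
      (simp add: group_perm_group finite_permutations finite_box \<phi>_hom)
qed

section \<open>The group with generators a and t\<close>

definition at_relation :: "(generator word \<times> generator word) set" where
  "at_relation = {([Gen gen_t, Gen gen_t, Gen gen_a, Inv gen_t, Inv gen_t], [Gen gen_a, Gen gen_a])}"

abbreviation at_class :: "generator word \<Rightarrow> generator word set" where
  "at_class \<equiv> word_class at_relation"

lemma G_at_eq: "G_at = presented_group at_relation"
  by (simp add: G_at_def at_relation_def)

lemma at_class_mult: "at_class u \<otimes>\<^bsub>G_at\<^esub> at_class v = at_class (u @ v)"
  by (simp add: G_at_eq mult_presented_group)

lemma at_class_inv: "inv\<^bsub>G_at\<^esub> (at_class [Gen x]) = at_class [Inv x]"
proof -
  interpret group G_at unfolding G_at_eq by (rule group_presented_group)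
  show ?thesis
  proof (rule inv_equality)
    show "at_class [Inv x] \<otimes>\<^bsub>G_at\<^esub> at_class [Gen x] = \<one>\<^bsub>G_at\<^esub>"
      by (simp add: at_class_mult)
        (simp add: G_at_eq one_presented_group word_class_eq_iff word_eq.cancel_left)
  qed (simp_all add: G_at_eq carrier_presented_group)
qed

lemma G_at_action:
  assumes N: "N > 0" "odd N"
  shows "\<exists>\<phi>\<in>hom G_at (perm_group (residue_box N)). \<phi> (at_class [Gen gen_a]) = induced N (shear 1)
    \<and> \<phi> (at_class [Gen gen_t]) = induced N (unturn N)"
proof -
  let ?P = "perm_group (residue_box N)"
  define f where "f x = (case x of gen_a \<Rightarrow> induced N (shear 1) | gen_t \<Rightarrow> induced N (unturn N))" for x
  interpret P: group ?P by (rule group_perm_group)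
  have perm: "f x permutes residue_box N" for x
    by (cases x) (simp_all add: f_def shear_permutes N induced_permutes[OF turn_unturn(2,1)[OF N]])
  have turn: "induced N turn permutes residue_box N"
    by (rule induced_permutes[OF turn_unturn[OF N]])
  have inv_t: "inv\<^bsub>?P\<^esub> (f gen_t) = induced N turn"
    using perm[of gen_t] turn by (intro P.inv_equality) (simp_all add: f_def turn_unturn N)
  have rel: "word_eval ?P f u = word_eval ?P f v" if "(u, v) \<in> at_relation" for u v
  proof -
    have "word_eval ?P f u = induced N (unturn N) \<circ>
        (induced N (unturn N) \<circ> induced N (shear 1) \<circ> induced N turn) \<circ> induced N turn"
      using that inv_t by (simp add: at_relation_def f_def comp_assoc)
    also have "\<dots> = induced N (shear 1) \<circ> induced N (shear 1)"
      using N by (simp add: unturn_shear_turn unturn_coshear_turn induced_comp periodic_shear shear_add)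
    finally show ?thesis using that by (simp add: at_relation_def f_def)
  qed
  obtain \<phi> where "\<phi> \<in> hom (presented_group at_relation) ?P" "\<And>u. \<phi> (at_class u) = word_eval ?P f u"
    using presented_group_hom[OF group_perm_group, of f "residue_box N" at_relation, OF _ rel] perm by auto
  then show ?thesis by (intro bexI[of _ \<phi>]) (simp_all add: f_def G_at_eq)
qed

lemma doubling_group_G_at: "doubling_group G_at (at_class [Gen gen_a]) (at_class [Gen gen_t])"
proof -
  interpret group G_at unfolding G_at_eq by (rule group_presented_group)
  have rel: "word_eq at_relation [Gen gen_t, Gen gen_t, Gen gen_a, Inv gen_t, Inv gen_t]
      [Gen gen_a, Gen gen_a]"
    by (rule word_eq.relation) (simp add: at_relation_def)
  show ?thesis
  proof
    show "at_class [Gen gen_t] \<otimes>\<^bsub>G_at\<^esub> at_class [Gen gen_t] \<otimes>\<^bsub>G_at\<^esub> at_class [Gen gen_a]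
        \<otimes>\<^bsub>G_at\<^esub> inv\<^bsub>G_at\<^esub> at_class [Gen gen_t] \<otimes>\<^bsub>G_at\<^esub> inv\<^bsub>G_at\<^esub> at_class [Gen gen_t]
      = at_class [Gen gen_a] \<otimes>\<^bsub>G_at\<^esub> at_class [Gen gen_a]"
      by (simp add: at_class_inv at_class_mult word_class_eq_iff rel)
  qed (simp_all add: G_at_eq carrier_presented_group)
qed

lemma G_at_normal_form:
  assumes "g \<in> carrier G_at"
  shows "doubling_group.normal_form G_at (at_class [Gen gen_a]) (at_class [Gen gen_t]) g"
proof -
  interpret doubling_group G_at "at_class [Gen gen_a]" "at_class [Gen gen_t]"
    by (rule doubling_group_G_at)
  obtain u where "g = at_class u" using assms by (auto simp: G_at_eq carrier_presented_group)
  moreover have "normal_form (at_class u)"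
  proof (induction u)
    case Nil
    show ?case using normal_form_one by (simp add: G_at_eq one_presented_group)
  next
    case (Cons l u)
    have split: "at_class (l # u) = at_class [l] \<otimes>\<^bsub>G_at\<^esub> at_class u" by (simp add: at_class_mult)
    have "normal_form (at_class [Gen x] \<otimes>\<^bsub>G_at\<^esub> at_class u)
        \<and> normal_form (inv\<^bsub>G_at\<^esub> at_class [Gen x] \<otimes>\<^bsub>G_at\<^esub> at_class u)" for x
    proof (cases x)
      case gen_a
      then show ?thesis
        using normal_form_syllable[OF Cons, of "(False, 1)"] normal_form_syllable[OF Cons, of "(False, - 1)"]
        by (simp add: int_pow_neg)
    next
      case gen_t
      then show ?thesis using normal_form_T normal_form_inv_T Cons by blast
    qed
    then show ?case unfolding split by (cases l) (auto simp flip: at_class_inv)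
  qed
  ultimately show ?thesis by simp
qed

theorem theorem4:
  shows "residually_finite G_at \<and> \<not> linear_over TYPE('k::field) G_at"
proof -
  obtain \<phi> where \<phi>: "\<And>N. N > 0 \<Longrightarrow> odd N \<Longrightarrow> \<phi> N \<in> hom G_at (perm_group (residue_box N))
      \<and> \<phi> N (at_class [Gen gen_a]) = induced N (shear 1)
      \<and> \<phi> N (at_class [Gen gen_t]) = induced N (unturn N)"
    using G_at_action by metis
  interpret doubling_group G_at "at_class [Gen gen_a]" "at_class [Gen gen_t]"
    by (rule doubling_group_G_at)
  interpret doubling_action G_at "at_class [Gen gen_a]" "at_class [Gen gen_t]" \<phi>
    by unfold_locales (use \<phi> in auto)
  show ?thesis using residually_finite[OF G_at_normal_form] not_linear by blast
qed

end
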